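(* Let $u$ be a weight on $\mathbb R$ and $w$ a weight on $(0,\infty)$. If $H:\Lambda^p_u(w)\to\Lambda^{p,\infty}_u(w)$ is bounded for some $0<p<\infty$, then $u\in A_\infty$.
   Context: A weight $u$ on $\mathbb R$ is locally integrable with $u>0$ a.e.; $u(E)=\int_Eu$. A weight $w$ on $(0,\infty)$ is nonnegative locally integrable, $W(t)=\int_0^tw$. $f^*_u(t)=\inf\{y>0:u(\{|f|>y\})\le t\}$; $\|f\|_{\Lambda^p_u(w)}=\left(\int_0^\infty(f^*_u)^pw\right)^{1/p}$, $\|f\|_{\Lambda^{p,\infty}_u(w)}=\sup_{t>0}f^*_u(t)W(t)^{1/p}$. $Hf(x)=\frac1\pi\lim_{\varepsilon\to0^+}\int_{|x-y|>\varepsilon}\frac{f(y)}{x-y}dy$; boundedness of $H$ means $Hf$ defined a.e. for every $f\in\Lambda^p_u(w)$ with $\|Hf\|_{\Lambda^{p,\infty}_u(w)}\le C\|f\|_{\Lambda^p_u(w)}$. $u\in A_\infty$: there exist $C>0$, $\delta\in(0,1)$ with $u(E)/u(I)\le C(|E|/|I|)^\delta$ for every interval $I$ and measurable $E\subset I$.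
   Formalization: The weight w is assumed integrable on every (0,t), so that W(t) is finite; with local integrability on (0,∞) only, w(t)=1/t gives Λ^p_u(w)={0}, H is trivially bounded, and the claim fails, e.g. for u(x)=e^x. *)

theory Defs
  imports "HOL-Analysis.Analysis"
begin

definition weight_R :: "(real \<Rightarrow> real) \<Rightarrow> bool" where
  "weight_R u \<longleftrightarrow> u \<in> borel_measurable lebesgue \<and>
     (\<forall>a b. set_integrable lebesgue {a..b} u) \<and>
     (AE x in lebesgue. u x > 0)"

text \<open>Weight on (0,infinity): nonnegative, locally integrable on [0,infinity), so W(t) is finite.\<close>
definition weight_pos :: "(real \<Rightarrow> real) \<Rightarrow> bool" where
  "weight_pos w \<longleftrightarrow> w \<in> borel_measurable lebesgue \<and>
     (\<forall>t>0. w t \<ge> 0) \<and>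
     (\<forall>t>0. set_integrable lebesgue {0<..<t} w)"

definition umeas :: "(real \<Rightarrow> real) \<Rightarrow> real set \<Rightarrow> ennreal" where
  "umeas u E = (\<integral>\<^sup>+ x\<in>E. ennreal (u x) \<partial>lebesgue)"

definition Wfun :: "(real \<Rightarrow> real) \<Rightarrow> real \<Rightarrow> ennreal" where
  "Wfun w t = (\<integral>\<^sup>+ s\<in>{0<..<t}. ennreal (w s) \<partial>lebesgue)"

definition epow :: "ennreal \<Rightarrow> real \<Rightarrow> ennreal" where
  "epow x p = (if x = \<infinity> then \<infinity> else ennreal (enn2real x powr p))"

definition fstar :: "(real \<Rightarrow> real) \<Rightarrow> (real \<Rightarrow> real) \<Rightarrow> real \<Rightarrow> ennreal" where
  "fstar u f t = Inf {ennreal y | y. y > 0 \<and> umeas u {x. \<bar>f x\<bar> > y} \<le> ennreal t}"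

definition lorentz_norm :: "(real \<Rightarrow> real) \<Rightarrow> (real \<Rightarrow> real) \<Rightarrow> real \<Rightarrow> (real \<Rightarrow> real) \<Rightarrow> ennreal" where
  "lorentz_norm u w p f =
     epow (\<integral>\<^sup>+ t\<in>{0<..}. epow (fstar u f t) p * ennreal (w t) \<partial>lebesgue) (1 / p)"

definition weak_lorentz_norm :: "(real \<Rightarrow> real) \<Rightarrow> (real \<Rightarrow> real) \<Rightarrow> real \<Rightarrow> (real \<Rightarrow> real) \<Rightarrow> ennreal" where
  "weak_lorentz_norm u w p f = (SUP t\<in>{0<..}. fstar u f t * epow (Wfun w t) (1 / p))"

definition in_lorentz :: "(real \<Rightarrow> real) \<Rightarrow> (real \<Rightarrow> real) \<Rightarrow> real \<Rightarrow> (real \<Rightarrow> real) \<Rightarrow> bool" where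
  "in_lorentz u w p f \<longleftrightarrow> f \<in> borel_measurable lebesgue \<and> lorentz_norm u w p f < \<infinity>"

definition hilbert_trunc :: "(real \<Rightarrow> real) \<Rightarrow> real \<Rightarrow> real \<Rightarrow> real" where
  "hilbert_trunc f \<epsilon> x = (LINT y:{y. \<bar>x - y\<bar> > \<epsilon>}|lebesgue. f y / (x - y))"

definition hilbert_defined_at :: "(real \<Rightarrow> real) \<Rightarrow> real \<Rightarrow> bool" where
  "hilbert_defined_at f x \<longleftrightarrow>
     (\<forall>\<epsilon>>0. set_integrable lebesgue {y. \<bar>x - y\<bar> > \<epsilon>} (\<lambda>y. f y / (x - y))) \<and>
     (\<exists>L. ((\<lambda>\<epsilon>. hilbert_trunc f \<epsilon> x) \<longlongrightarrow> L) (at_right 0))"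

definition hilbert :: "(real \<Rightarrow> real) \<Rightarrow> real \<Rightarrow> real" where
  "hilbert f x = (1 / pi) * Lim (at_right 0) (\<lambda>\<epsilon>. hilbert_trunc f \<epsilon> x)"

definition hilbert_bounded :: "(real \<Rightarrow> real) \<Rightarrow> (real \<Rightarrow> real) \<Rightarrow> real \<Rightarrow> bool" where
  "hilbert_bounded u w p \<longleftrightarrow> (\<exists>C::real. \<forall>f. in_lorentz u w p f \<longrightarrow>
      (AE x in lebesgue. hilbert_defined_at f x) \<and>
      weak_lorentz_norm u w p (hilbert f) \<le> ennreal C * lorentz_norm u w p f)"

definition A_infty :: "(real \<Rightarrow> real) \<Rightarrow> bool" where
  "A_infty u \<longleftrightarrow> (\<exists>C>0. \<exists>\<delta>. 0 < \<delta> \<and> \<delta> < 1 \<and>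
     (\<forall>a b E. a < b \<longrightarrow> E \<in> sets lebesgue \<longrightarrow> E \<subseteq> {a..b} \<longrightarrow>
        enn2real (umeas u E) / enn2real (umeas u {a..b})
          \<le> C * (measure lebesgue E / (b - a)) powr \<delta>))"

end

theory Submission
  imports Defs "HOL-Computational_Algebra.Polynomial"
begin

text \<open>
  If \<open>\<bar>f\<bar> \<le> 1\<close> is supported in an interval \<open>J\<close> and \<open>\<bar>Hf\<bar> \<ge> l\<close> on \<open>S\<close>, boundedness of the Hilbert
  transform gives \<open>l\<^sup>p W(u(S)) \<le> C W(u(J))\<close>. Indicators of intervals show that \<open>W(u(\<cdot>))\<close> is
  doubling on intervals; choosing a quarter of \<open>I\<close> of small \<open>u\<close>-measure, this becomes
  \<open>W(u(I)) \<le> C W(u(I)/4)\<close>.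

  If \<open>S \<subseteq> I\<close> is a union of separated intervals \<open>(c\<^sub>i, d\<^sub>i)\<close> with \<open>M \<bar>S\<bar> \<le> \<bar>I\<bar>\<close>, put
  \<open>P = \<Prod>(x - c\<^sub>i)\<close> and \<open>Q = \<Prod>(x - d\<^sub>i)\<close>. The monic polynomials
  \<open>N = ((M + 1) Q - (M - 1) P) / 2\<close> and \<open>D = ((M + 1) Q + (M - 1) P) / (2 M)\<close> have interlacing real
  roots \<open>a\<^sub>i\<close> and \<open>b\<^sub>i\<close>, and \<open>\<bar>N\<bar> \<ge> M \<bar>D\<bar>\<close> on \<open>S\<close> because \<open>P Q < 0\<close> there. The indicator of the union
  of the intervals \<open>[b\<^sub>i, a\<^sub>i]\<close> has Hilbert transform \<open>ln \<bar>D / N\<bar> / \<pi>\<close>, so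
  \<open>(ln M)\<^sup>p W(u(S)) \<le> C W(u(I))\<close>. For \<open>M\<close> large this forces \<open>u(S) \<le> u(I)/4\<close>, provided
  \<open>W(u(I)) > 0\<close>; otherwise functions with a non-integrable singularity in \<open>I\<close> have norm \<open>0\<close>
  although their Hilbert transform is undefined. A dyadic stopping-time argument turns
  ``\<open>\<bar>S\<bar> \<le> \<eta> \<bar>I\<bar>\<close> implies \<open>u(S) \<le> u(I)/2\<close>'' into the power bound of \<open>A\<^sub>\<infinity>\<close>.
\<close>

subsection \<open>Sets on which a Hilbert transform is uniformly large\<close>

text \<open>The difference of the two sides has degree below \<open>n\<close> and vanishes at
  \<open>n\<close> distinct points. Used to factor \<open>N\<close> and \<open>D\<close> once their
  roots have been located.\<close>

lemma monic_poly_eq_prod_roots: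
  fixes p :: "real poly" and r :: "nat \<Rightarrow> real"
  assumes "degree p \<le> n" "coeff p n = 1" "inj_on r {..<n}" "\<And>i. i < n \<Longrightarrow> poly p (r i) = 0"
  shows "p = (\<Prod>i<n. [:- r i, 1:])"
proof (rule poly_eqI_degree_lead_coeff[where A = "r ` {..<n}" and n = n])
  have deg: "degree (\<Prod>i<n. [:- r i, 1:]) = n"
    by (subst degree_prod_eq_sum_degree) auto
  then show "degree (\<Prod>i<n. [:- r i, 1:]) \<le> n" by simp
  have "coeff (\<Prod>i<n. [:- r i, 1:]) n = 1"
    using lead_coeff_prod[of "\<lambda>i. [:- r i, 1:]" "{..<n}"] unfolding deg by simp
  then show "coeff p n = coeff (\<Prod>i<n. [:- r i, 1:]) n"
    using assms by simp
  show "n \<le> card (r ` {..<n})"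
    using assms(3) by (simp add: card_image)
  fix z assume "z \<in> r ` {..<n}"
  then show "poly p z = poly (\<Prod>i<n. [:- r i, 1:]) z"
    using assms(4) by (auto simp: poly_prod)
qed (use assms in auto)

text \<open>The roots come from sign changes: \<open>D\<close> has one inside each
  \<open>(c i, d i)\<close>, \<open>N\<close> one in each gap up to the next \<open>c\<close>, and
  the degree bound \<open>n\<close> makes these all the roots. Separation keeps the gaps open;
  sparseness confines the last root of \<open>N\<close>. The points \<open>b j\<close> and
  \<open>a j\<close> are excluded because \<open>ln \<bar>D / N\<bar>\<close> has its singularities
  there.\<close>

lemma interlacing_log_quotient:
  fixes c d :: "nat \<Rightarrow> real" and lo hi M :: real
  assumes cd: "\<And>i. i < n \<Longrightarrow> c i < d i"
    and sep: "\<And>i j. i < j \<Longrightarrow> j < n \<Longrightarrow> d i < c j"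
    and sub: "\<And>i. i < n \<Longrightarrow> lo \<le> c i \<and> d i \<le> hi"
    and M: "2 \<le> M" and small: "M * (\<Sum>i<n. d i - c i) \<le> hi - lo"
    and lohi: "lo < hi"
  obtains a b :: "nat \<Rightarrow> real"
  where "\<And>i. i < n \<Longrightarrow> lo \<le> b i \<and> b i < a i \<and> a i \<le> 2 * hi - lo"
    and "\<And>i j. i < j \<Longrightarrow> j < n \<Longrightarrow> a i < b j"
    and "\<And>i x. i < n \<Longrightarrow> c i < x \<Longrightarrow> x < d i \<Longrightarrow> (\<And>j. j < n \<Longrightarrow> x \<noteq> b j \<and> x \<noteq> a j) \<Longrightarrow>
      ln M \<le> \<bar>\<Sum>j<n. ln \<bar>x - b j\<bar> - ln \<bar>x - a j\<bar>\<bar>"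
proof -
  define P Q where "P = (\<Prod>i<n. [:- c i, 1:])" and "Q = (\<Prod>i<n. [:- d i, 1:])"
  \<comment> \<open>\<open>N\<close> and \<open>M * D\<close> are
    \<open>\<alpha> Q - \<beta> P\<close> and \<open>\<alpha> Q + \<beta> P\<close> with
    \<open>\<alpha> - \<beta> = 1\<close> and \<open>\<alpha> + \<beta> = M\<close>. These two
    equations make both polynomials monic.\<close>
  define N D where "N = smult ((M + 1) / 2) Q - smult ((M - 1) / 2) P"
    and "D = smult ((M + 1) / (2 * M)) Q + smult ((M - 1) / (2 * M)) P"
  have polyP: "poly P x = (\<Prod>i<n. x - c i)" and polyQ: "poly Q x = (\<Prod>i<n. x - d i)" for x
    by (auto simp: P_def Q_def poly_prod)
  have polyN: "poly N x = ((M + 1) * poly Q x - (M - 1) * poly P x) / 2" for x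
    by (simp add: N_def field_simps)
  have polyD: "poly D x = ((M + 1) * poly Q x + (M - 1) * poly P x) / (2 * M)" for x
    using M by (simp add: D_def field_simps)
  have degP: "degree P = n" and degQ: "degree Q = n"
    unfolding P_def Q_def by (subst degree_prod_eq_sum_degree; simp)+
  have lcP: "coeff P n = 1" and lcQ: "coeff Q n = 1"
    using lead_coeff_prod[of "\<lambda>i. [:- c i, 1:]" "{..<n}"]
      lead_coeff_prod[of "\<lambda>i. [:- d i, 1:]" "{..<n}"] degP degQ
    unfolding P_def Q_def by simp_all
  have degN: "degree N \<le> n" and degD: "degree D \<le> n"
    unfolding N_def D_def using degP degQ
    by (auto intro!: degree_diff_le degree_add_le order_trans[OF degree_smult_le])
  have lcN: "coeff N n = 1" and lcD: "coeff D n = 1"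
    using M by (simp_all add: N_def D_def lcP lcQ field_simps)
  \<comment> \<open>For \<open>k \<noteq> i\<close> both \<open>c i\<close> and \<open>d i\<close>
    lie on the same side of the \<open>k\<close>-th interval, so only the factor
    \<open>k = i\<close> is negative.\<close>
  have PQ_cd: "poly Q (c i) * poly P (d i) < 0" if "i < n" for i
  proof -
    have "poly Q (c i) * poly P (d i) = (\<Prod>k<n. (c i - d k) * (d i - c k))"
      by (simp add: polyP polyQ prod.distrib)
    also have "\<dots> = ((c i - d i) * (d i - c i)) * (\<Prod>k\<in>{..<n} - {i}. (c i - d k) * (d i - c k))"
      using that by (subst prod.remove[of _ i]) auto
    also have "\<dots> < 0"
    proof (rule mult_neg_pos)
      show "(c i - d i) * (d i - c i) < 0"
        using cd[OF that] by (intro mult_neg_pos) auto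
      show "0 < (\<Prod>k\<in>{..<n} - {i}. (c i - d k) * (d i - c k))"
      proof (rule prod_pos)
        fix k assume k: "k \<in> {..<n} - {i}"
        show "0 < (c i - d k) * (d i - c k)"
        proof (cases "k < i")
          case True
          then show ?thesis using sep[OF True that] cd[of k] cd[of i] k that
            by (intro mult_pos_pos) auto
        next
          case False
          then have "i < k" using k by auto
          then show ?thesis using sep[of i k] cd[of k] cd[of i] k that
            by (intro mult_neg_neg) auto
        qed
      qed
    qed
    finally show ?thesis .
  qed
  \<comment> \<open>No interval lies between \<open>d i\<close> and the next \<open>c\<close>, so
    here the two entries of every factor agree in sign.\<close>
  have PQ_dc: "poly P (d i) * poly Q (c (Suc i)) > 0" if "Suc i < n" for i
  proof -
    have "poly P (d i) * poly Q (c (Suc i)) = (\<Prod>k<n. (d i - c k) * (c (Suc i) - d k))"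
      by (simp add: polyP polyQ prod.distrib)
    also have "\<dots> > 0"
    proof (rule prod_pos)
      fix k assume k: "k \<in> {..<n}"
      have i: "d i < c (Suc i)" using sep that by auto
      show "0 < (d i - c k) * (c (Suc i) - d k)"
      proof (cases "k \<le> i")
        case True
        then have "d k \<le> d i" using sep[of k i] cd[of i] that by (cases "k = i") auto
        then show ?thesis using i cd[of k] k by (intro mult_pos_pos) auto
      next
        case False
        then have "c (Suc i) \<le> c k"
          using sep[of "Suc i" k] cd[of "Suc i"] that k by (cases "k = Suc i") auto
        then show ?thesis using i cd[of k] k by (intro mult_neg_neg) auto
      qed
    qed
    finally show ?thesis .
  qed
  have zero_P: "poly P (c i) = 0" and zero_Q: "poly Q (d i) = 0" if "i < n" for i
    using that by (auto simp: polyP polyQ)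
  \<comment> \<open>At \<open>c i\<close> only \<open>Q\<close> survives and at \<open>d i\<close>
    only \<open>P\<close>, so \<open>PQ_cd\<close> yields a sign change of \<open>D\<close>.\<close>
  have "\<exists>x>c i. x < d i \<and> poly D x = 0" if "i < n" for i
  proof (rule poly_IVT[OF cd[OF that]])
    have "poly D (c i) * poly D (d i) =
      (M + 1) * (M - 1) / (4 * M\<^sup>2) * (poly Q (c i) * poly P (d i))"
      using zero_P zero_Q that M by (simp add: polyD field_simps power2_eq_square)
    also have "\<dots> < 0" using PQ_cd[OF that] M by (intro mult_pos_neg[OF _ PQ_cd[OF that]]) auto
    finally show "poly D (c i) * poly D (d i) < 0" .
  qed
  then obtain b where b: "\<And>i. i < n \<Longrightarrow> c i < b i \<and> b i < d i \<and> poly D (b i) = 0"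
    by metis
  have "\<exists>x>d i. x < (if Suc i < n then c (Suc i) else 2 * hi - lo) \<and> poly N x = 0"
    if "i < n" for i
  proof (cases "Suc i < n")
    case True
    have "poly N (d i) * poly N (c (Suc i)) =
      - ((M + 1) * (M - 1) / 4 * (poly P (d i) * poly Q (c (Suc i))))"
      using zero_P zero_Q that True by (simp add: polyN field_simps)
    also have "\<dots> < 0" using PQ_dc[OF True] M by auto
    finally show ?thesis using poly_IVT[of "d i" "c (Suc i)" N] True sep by auto
  next
    case False
    then have i: "Suc i = n" using that by simp
    \<comment> \<open>To the right of the last interval there is no next \<open>c\<close> to produce
      a sign change. At \<open>e\<close>, the reflection of \<open>lo\<close> in \<open>hi\<close>,
      every \<open>e - d k\<close> is at least \<open>hi - lo\<close>; hence \<open>P / Q\<close> is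
      at most \<open>exp s\<close> with \<open>M * s \<le> 1\<close>, small enough for
      \<open>N\<close> to be positive.\<close>
    define e where "e = 2 * hi - lo"
    have e: "d j \<le> hi" "hi < e" if "j < n" for j
      using sub[OF that] lohi by (auto simp: e_def)
    have dc: "0 < poly P (d i)"
      unfolding polyP
    proof (rule prod_pos)
      fix k assume "k \<in> {..<n}"
      then show "0 < d i - c k"
        using sep[of k i] cd[of k] cd[of i] i by (cases "k = i") auto
    qed
    then have neg: "poly N (d i) < 0"
      using zero_Q[OF that] M by (simp add: polyN)
    have Qe: "0 < poly Q e"
      unfolding polyQ using e by (intro prod_pos) force
    define s where "s = (\<Sum>k<n. d k - c k) / (hi - lo)"
    have s0: "0 \<le> s" unfolding s_def using cd lohi
      by (intro divide_nonneg_pos sum_nonneg) (auto intro: less_imp_le)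
    have Ms: "M * s \<le> 1" using small lohi by (simp add: s_def field_simps)
    have "M * s \<ge> 2 * s" using M s0 by (intro mult_right_mono) auto
    then have s1: "s \<le> 1" using Ms s0 by auto
    have "poly P e = poly Q e * (\<Prod>k<n. 1 + (d k - c k) / (e - d k))"
      unfolding polyP polyQ prod.distrib[symmetric]
      using e by (intro prod.cong refl) (force simp: field_simps)
    also have "(\<Prod>k<n. 1 + (d k - c k) / (e - d k)) \<le> (\<Prod>k<n. exp ((d k - c k) / (hi - lo)))"
    proof (rule prod_mono)
      fix k assume k: "k \<in> {..<n}"
      have "0 < e - d k" using e k by force
      then have "0 \<le> (d k - c k) / (e - d k)" using cd[of k] k by auto
      moreover have "(d k - c k) / (e - d k) \<le> (d k - c k) / (hi - lo)"
        using e[of k] cd[of k] k lohi by (intro divide_left_mono mult_pos_pos) (auto simp: e_def)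
      ultimately show "0 \<le> 1 + (d k - c k) / (e - d k) \<and>
        1 + (d k - c k) / (e - d k) \<le> exp ((d k - c k) / (hi - lo))"
        using exp_ge_add_one_self[of "(d k - c k) / (hi - lo)"] by linarith
    qed
    also have "\<dots> = exp s" by (simp add: exp_sum[symmetric] s_def sum_divide_distrib)
    also have "exp s \<le> 1 + s + s\<^sup>2" using s0 s1 by (rule exp_bound)
    finally have PQ: "poly P e \<le> poly Q e * (1 + s + s\<^sup>2)" using Qe by simp
    \<comment> \<open>Strictness comes from the leftover \<open>- 2 * s\<close>, or for
      \<open>s = 0\<close> directly from \<open>M - 1 < M + 1\<close>.\<close>
    have "(M - 1) * (1 + s + s\<^sup>2) < M + 1"
    proof -
      have "s\<^sup>2 \<le> s" using s0 s1 by (simp add: power2_eq_square mult_left_le)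
      then have "(M - 1) * (1 + s + s\<^sup>2) \<le> (M - 1) * (1 + 2 * s)"
        using M by (intro mult_left_mono) auto
      also have "\<dots> = M - 1 + 2 * (M * s) - 2 * s" by (simp add: algebra_simps)
      also have "\<dots> \<le> M + 1 - 2 * s" using Ms by simp
      finally show ?thesis using s0 Ms by (cases "s = 0") auto
    qed
    then have "(M - 1) * (1 + s + s\<^sup>2) * poly Q e < (M + 1) * poly Q e"
      using Qe by (intro mult_strict_right_mono)
    moreover have "(M - 1) * poly P e \<le> (M - 1) * (poly Q e * (1 + s + s\<^sup>2))"
      using PQ M by (intro mult_left_mono) auto
    ultimately have "(M - 1) * poly P e < (M + 1) * poly Q e" by (simp add: mult_ac)
    then have pos: "0 < poly N e" by (simp add: polyN)
    show ?thesis using poly_IVT_pos[OF _ neg pos] e[OF that] False by (auto simp: e_def)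
  qed
  then obtain a where a: "\<And>i. i < n \<Longrightarrow>
      d i < a i \<and> a i < (if Suc i < n then c (Suc i) else 2 * hi - lo) \<and> poly N (a i) = 0"
    by metis
  have ca: "a i < c j" if "i < j" "j < n" for i j
  proof -
    have "c (Suc i) \<le> c j"
      using that sep[of "Suc i" j] cd[of "Suc i"] by (cases "Suc i = j") auto
    then show ?thesis using a[of i] that by auto
  qed
  have ab: "a i < b j" if "i < j" "j < n" for i j
    using ca[OF that] b[OF that(2)] by simp
  have ba: "b i < a i" if "i < n" for i
    using a b that by force
  have "b i < b j" "a i < a j" if "i < j" "j < n" for i j
    using ab[OF that] ba[of i] ba[of j] that by auto
  then have injb: "inj_on b {..<n}" and inja: "inj_on a {..<n}"
    by (fastforce intro!: linorder_inj_onI')+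
  have N: "N = (\<Prod>i<n. [:- a i, 1:])" and D: "D = (\<Prod>i<n. [:- b i, 1:])"
    using monic_poly_eq_prod_roots[OF degN lcN inja] monic_poly_eq_prod_roots[OF degD lcD injb] a b
    by auto
  show ?thesis
  proof (rule that[of b a])
    fix i assume i: "i < n"
    have "a i \<le> 2 * hi - lo"
      using a[OF i] sub[of "Suc i"] cd[of "Suc i"] lohi by (auto split: if_splits)
    then show "lo \<le> b i \<and> b i < a i \<and> a i \<le> 2 * hi - lo"
      using b[OF i] sub[OF i] ba[OF i] by auto
  next
    fix i x assume i: "i < n" and x: "c i < x" "x < d i"
      and nz: "\<And>j. j < n \<Longrightarrow> x \<noteq> b j \<and> x \<noteq> a j"
    have "poly P x * poly Q x = (\<Prod>k<n. (x - c k) * (x - d k))"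
      by (simp add: polyP polyQ prod.distrib)
    also have "\<dots> = ((x - c i) * (x - d i)) * (\<Prod>k\<in>{..<n} - {i}. (x - c k) * (x - d k))"
      using i by (subst prod.remove[of _ i]) auto
    also have "\<dots> < 0"
    proof (rule mult_neg_pos)
      show "(x - c i) * (x - d i) < 0" using x by (intro mult_pos_neg) auto
      show "0 < (\<Prod>k\<in>{..<n} - {i}. (x - c k) * (x - d k))"
      proof (rule prod_pos)
        fix k assume k: "k \<in> {..<n} - {i}"
        show "0 < (x - c k) * (x - d k)"
        proof (cases "k < i")
          case True
          then show ?thesis using sep[OF True i] cd[of k] k x by (intro mult_pos_pos) auto
        next
          case False
          then show ?thesis using sep[of i k] cd[of k] k x by (intro mult_neg_neg) auto
        qed
      qed
    qed
    finally have opp: "poly P x * poly Q x < 0" .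
    have "M * \<bar>poly D x\<bar> = \<bar>(M + 1) * poly Q x + (M - 1) * poly P x\<bar> / 2"
      using M by (simp add: polyD abs_mult)
    also have "\<dots> \<le> \<bar>(M + 1) * poly Q x - (M - 1) * poly P x\<bar> / 2"
    proof -
      have "(M + 1) * poly Q x * ((M - 1) * poly P x) = (M + 1) * (M - 1) * (poly P x * poly Q x)"
        by simp
      also have "\<dots> \<le> 0" using M by (intro mult_nonneg_nonpos less_imp_le[OF opp]) auto
      finally have "(M + 1) * poly Q x * ((M - 1) * poly P x) \<le> 0" .
      moreover have "\<bar>r + s\<bar> \<le> \<bar>r - s\<bar>" if "r * s \<le> 0" for r s :: real
        using that by (auto simp: mult_le_0_iff)
      ultimately show ?thesis by (intro divide_right_mono) auto
    qed
    also have "\<dots> = \<bar>poly N x\<bar>" by (simp add: polyN)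
    finally have MD: "M * \<bar>poly D x\<bar> \<le> \<bar>poly N x\<bar>" .
    have nzD: "poly D x \<noteq> 0" using nz by (auto simp: D poly_prod)
    have "ln M + ln \<bar>poly D x\<bar> = ln (M * \<bar>poly D x\<bar>)"
      using M nzD by (subst ln_mult) auto
    also have "\<dots> \<le> ln \<bar>poly N x\<bar>"
      using MD M nzD by (intro ln_mono) auto
    finally have 1: "ln M \<le> ln \<bar>poly N x\<bar> - ln \<bar>poly D x\<bar>" by simp
    have "ln \<bar>poly N x\<bar> = (\<Sum>j<n. ln \<bar>x - a j\<bar>)"
      unfolding N poly_prod abs_prod using nz by (subst ln_prod) auto
    moreover have "ln \<bar>poly D x\<bar> = (\<Sum>j<n. ln \<bar>x - b j\<bar>)"
      unfolding D poly_prod abs_prod using nz by (subst ln_prod) auto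
    ultimately show "ln M \<le> \<bar>\<Sum>j<n. ln \<bar>x - b j\<bar> - ln \<bar>x - a j\<bar>\<bar>"
      using 1 by (simp add: sum_subtractf)
  qed (fact ab)
qed

section \<open>Hilbert transforms of indicators and of a non-integrable singularity\<close>

lemma has_bochner_integral_inverse_diff:
  fixes c d x :: real
  assumes "c \<le> d" "x < c \<or> d < x"
  shows "has_bochner_integral lebesgue (\<lambda>y. indicator {c..d} y / (x - y)) (ln \<bar>x - c\<bar> - ln \<bar>x - d\<bar>)"
proof -
  have "has_bochner_integral lborel (\<lambda>y. (1 / (x - y)) * indicator {c..d} y)
      ((\<lambda>y. - ln \<bar>x - y\<bar>) d - (\<lambda>y. - ln \<bar>x - y\<bar>) c)"
  proof (rule has_bochner_integral_FTC_Icc_real[OF assms(1)])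
    fix y assume y: "c \<le> y" "y \<le> d"
    then have nz: "x - y \<noteq> 0" using assms by auto
    show "isCont (\<lambda>y. 1 / (x - y)) y"
      using nz by (intro continuous_intros) auto
    have "((\<lambda>y. - (ln \<bar>x - y\<bar>)) has_real_derivative 1 / (x - y)) (at y)"
    proof (cases "x < c")
      case True
      have "((\<lambda>y. - ln (y - x)) has_real_derivative 1 / (x - y)) (at y)"
        using True y by (auto intro!: derivative_eq_intros simp: field_simps)
      moreover have "\<forall>\<^sub>F z in nhds y. - ln (z - x) = - ln \<bar>x - z\<bar>"
        using eventually_nhds_in_open[of "{x<..}" y] True y
        by (auto elim!: eventually_mono simp: abs_if)
      ultimately show ?thesis by (subst (asm) DERIV_cong_ev[OF refl _ refl]) auto
    next
      case False
      then have "d < x" using assms by auto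
      have "((\<lambda>y. - ln (x - y)) has_real_derivative 1 / (x - y)) (at y)"
        using \<open>d < x\<close> y by (auto intro!: derivative_eq_intros simp: field_simps)
      moreover have "\<forall>\<^sub>F z in nhds y. - ln (x - z) = - ln \<bar>x - z\<bar>"
        using eventually_nhds_in_open[of "{..<x}" y] \<open>d < x\<close> y
        by (auto elim!: eventually_mono simp: abs_if)
      ultimately show ?thesis by (subst (asm) DERIV_cong_ev[OF refl _ refl]) auto
    qed
    then show "((\<lambda>y. - ln \<bar>x - y\<bar>) has_real_derivative 1 / (x - y)) (at y)" .
  qed
  then have "has_bochner_integral lborel (\<lambda>y. indicator {c..d} y / (x - y)) (ln \<bar>x - c\<bar> - ln \<bar>x - d\<bar>)"
    by simp
  moreover have "(\<lambda>y. indicator {c..d} y / (x - y)) \<in> borel_measurable lborel"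
    by measurable
  ultimately show ?thesis
    unfolding has_bochner_integral_iff by (simp add: integrable_completion integral_completion)
qed

text \<open>If \<open>x\<close> lies inside the interval, the two remaining pieces contribute
  \<open>- ln \<epsilon>\<close> and \<open>+ ln \<epsilon>\<close>, which cancel because the
  removed window is symmetric. If \<open>x\<close> lies outside, the window misses the interval.
  Either way the value does not depend on \<open>\<epsilon>\<close>, so the principal value limit is
  that of an eventually constant function.\<close>

lemma has_bochner_integral_trunc_indicator:
  fixes c d x \<epsilon> :: real
  assumes "c < d" "0 < \<epsilon>" "\<epsilon> < \<bar>x - c\<bar>" "\<epsilon> < \<bar>x - d\<bar>"
  shows "has_bochner_integral lebesgue
    (\<lambda>y. indicator {y. \<bar>x - y\<bar> > \<epsilon>} y *\<^sub>R (indicator {c..d} y / (x - y))) (ln \<bar>x - c\<bar> - ln \<bar>x - d\<bar>)"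
proof (cases "x < c \<or> d < x")
  case True
  have "(\<lambda>y. indicator {y. \<bar>x - y\<bar> > \<epsilon>} y *\<^sub>R (indicator {c..d} y / (x - y))) =
      (\<lambda>y. indicator {c..d} y / (x - y))"
    using True assms by (auto simp: fun_eq_iff split: split_indicator)
  then show ?thesis using has_bochner_integral_inverse_diff[OF _ True] assms by simp
next
  case False
  then have x: "c < x - \<epsilon>" "x + \<epsilon> < d" using assms by auto
  have "has_bochner_integral lebesgue
      (\<lambda>y. indicator {c..x - \<epsilon>} y / (x - y) + indicator {x + \<epsilon>..d} y / (x - y))
      ((ln \<bar>x - c\<bar> - ln \<bar>x - (x - \<epsilon>)\<bar>) + (ln \<bar>x - (x + \<epsilon>)\<bar> - ln \<bar>x - d\<bar>))"
    using x assms by (intro has_bochner_integral_add has_bochner_integral_inverse_diff) auto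
  then have "has_bochner_integral lebesgue
      (\<lambda>y. indicator {c..x - \<epsilon>} y / (x - y) + indicator {x + \<epsilon>..d} y / (x - y))
      (ln \<bar>x - c\<bar> - ln \<bar>x - d\<bar>)"
    by simp
  then show ?thesis
  proof (rule has_bochner_integralI_AE)
    have "(\<lambda>y. indicator {y. \<bar>x - y\<bar> > \<epsilon>} y *\<^sub>R (indicator {c..d} y / (x - y))) \<in> borel_measurable lborel"
      by measurable
    then show "(\<lambda>y. indicator {y. \<bar>x - y\<bar> > \<epsilon>} y *\<^sub>R (indicator {c..d} y / (x - y))) \<in> borel_measurable lebesgue"
      by (rule measurable_completion)
    have "{x - \<epsilon>, x + \<epsilon>} \<in> null_sets lebesgue"
      by (intro null_sets_completionI) (simp add: finite_imp_null_set_lborel)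
    then have "AE y in lebesgue. y \<notin> {x - \<epsilon>, x + \<epsilon>}"
      by (rule AE_not_in)
    then show "AE y in lebesgue. indicator {c..x - \<epsilon>} y / (x - y) + indicator {x + \<epsilon>..d} y / (x - y) =
        indicator {y. \<bar>x - y\<bar> > \<epsilon>} y *\<^sub>R (indicator {c..d} y / (x - y))"
      by eventually_elim (use x assms in \<open>auto split: split_indicator\<close>)
  qed
qed

lemma hilbert_sum_indicator:
  fixes b a :: "nat \<Rightarrow> real"
  assumes ba: "\<And>i. i < n \<Longrightarrow> b i < a i" and x: "\<And>i. i < n \<Longrightarrow> x \<noteq> b i \<and> x \<noteq> a i"
  shows "hilbert (\<lambda>y. \<Sum>i<n. indicator {b i..a i} y) x = (\<Sum>i<n. ln \<bar>x - b i\<bar> - ln \<bar>x - a i\<bar>) / pi"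
proof -
  let ?f = "\<lambda>y. \<Sum>i<n. indicator {b i..a i} y :: real"
  define L where "L = (\<Sum>i<n. ln \<bar>x - b i\<bar> - ln \<bar>x - a i\<bar>)"
  have small: "\<forall>\<^sub>F \<epsilon> in at_right 0. 0 < \<epsilon> \<and> (\<forall>i\<in>{..<n}. \<epsilon> < \<bar>x - b i\<bar> \<and> \<epsilon> < \<bar>x - a i\<bar>)"
    using x by (intro eventually_conj eventually_ball_finite ballI eventually_at_right_less)
      (auto intro!: eventually_at_right_real order_tendstoD(2)[OF tendsto_ident_at])
  have "\<forall>\<^sub>F \<epsilon> in at_right 0. hilbert_trunc ?f \<epsilon> x = L"
    using small
  proof eventually_elim
    case (elim \<epsilon>)
    have "has_bochner_integral lebesgue
      (\<lambda>y. \<Sum>i<n. indicator {y. \<bar>x - y\<bar> > \<epsilon>} y *\<^sub>R (indicator {b i..a i} y / (x - y))) L"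
      unfolding L_def using elim ba
      by (intro has_bochner_integral_sum has_bochner_integral_trunc_indicator) auto
    then have "has_bochner_integral lebesgue
      (\<lambda>y. indicator {y. \<bar>x - y\<bar> > \<epsilon>} y *\<^sub>R (?f y / (x - y))) L"
      by (simp add: sum_distrib_left sum_divide_distrib)
    then show ?case
      unfolding hilbert_trunc_def set_lebesgue_integral_def by (rule has_bochner_integral_integral_eq)
  qed
  then have "((\<lambda>\<epsilon>. hilbert_trunc ?f \<epsilon> x) \<longlongrightarrow> L) (at_right 0)"
    by (rule tendsto_eventually)
  then show ?thesis
    unfolding hilbert_def L_def[symmetric] by (subst tendsto_Lim) auto
qed

text \<open>Let \<open>r > s\<close> be the distances from \<open>x\<close> to the two ends. Then
  \<open>r - s = d - c\<close>, and
  \<open>ln (r / s) \<ge> 1 - s / r = (d - c) / r \<ge> (d - c) / l\<close>.\<close>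

lemma hilbert_indicator_lower_bound:
  fixes c d x l :: real
  assumes "c < d" "x < c \<or> d < x" "\<bar>x - c\<bar> \<le> l" "\<bar>x - d\<bar> \<le> l"
  shows "(d - c) / (pi * l) \<le> \<bar>hilbert (indicator {c..d}) x\<bar>"
proof -
  have *: "(d - c) / l \<le> \<bar>ln \<bar>x - c\<bar> - ln \<bar>x - d\<bar>\<bar>"
    if "0 < s" "s < r" "r \<le> l" "r - s = d - c" "{r, s} = {\<bar>x - c\<bar>, \<bar>x - d\<bar>}" for r s :: real
  proof -
    have "(d - c) / l \<le> (d - c) / r"
      using that assms(1) by (intro divide_left_mono) auto
    also have "\<dots> = 1 - s / r"
      using that(1,2) unfolding that(4)[symmetric] by (simp add: field_simps)
    also have "\<dots> \<le> - ln (s / r)" using ln_le_minus_one[of "s / r"] that by simp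
    also have "\<dots> = ln r - ln s" using that by (simp add: ln_div)
    finally have "(d - c) / l \<le> ln r - ln s" .
    moreover have "\<bar>x - c\<bar> = r \<and> \<bar>x - d\<bar> = s \<or> \<bar>x - c\<bar> = s \<and> \<bar>x - d\<bar> = r"
      using that(5) by (simp only: doubleton_eq_iff) auto
    moreover have "\<bar>ln r - ln s\<bar> = \<bar>ln s - ln r\<bar>" by (rule abs_minus_commute)
    ultimately show ?thesis by (metis abs_ge_self order_trans)
  qed
  have "(d - c) / l \<le> \<bar>ln \<bar>x - c\<bar> - ln \<bar>x - d\<bar>\<bar>"
    using assms *[of "\<bar>x - c\<bar>" "\<bar>x - d\<bar>"] *[of "\<bar>x - d\<bar>" "\<bar>x - c\<bar>"] by (auto simp: insert_commute)
  moreover have "hilbert (indicator {c..d}) x = (ln \<bar>x - c\<bar> - ln \<bar>x - d\<bar>) / pi"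
    using hilbert_sum_indicator[of 1 "\<lambda>_. c" "\<lambda>_. d" x] assms by auto
  ultimately have "(d - c) / l \<le> pi * \<bar>hilbert (indicator {c..d}) x\<bar>" by (simp add: abs_mult)
  then have "(d - c) / l / pi \<le> pi * \<bar>hilbert (indicator {c..d}) x\<bar> / pi"
    by (intro divide_right_mono) auto
  then show ?thesis by (simp add: mult.commute)
qed

text \<open>For \<open>x\<close> to the right of \<open>b\<close>, a small truncation leaves the
  whole support in place and the kernel is bounded below there, so the integrability demanded by
  \<open>hilbert_defined_at\<close> would make \<open>1 / (y - a)\<close> integrable near
  \<open>a\<close>. Such \<open>x\<close> fill an interval of positive measure.\<close>

lemma not_AE_hilbert_defined_inverse:
  fixes a b :: real
  assumes "a < b"
  shows "\<not> (AE x in lebesgue. hilbert_defined_at (\<lambda>y. indicator {a<..b} y / (y - a)) x)"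
proof
  let ?f = "\<lambda>y. indicator {a<..b} y / (y - a)"
  assume ae: "AE x in lebesgue. hilbert_defined_at ?f x"
  have "\<exists>x\<in>{b<..<b + 1}. hilbert_defined_at ?f x"
  proof (rule ccontr)
    assume "\<not> ?thesis"
    then have "AE x in lebesgue. x \<notin> {b<..<b + 1}" using ae by (auto elim!: eventually_mono)
    then have "emeasure lebesgue {b<..<b + 1} = 0"
      by (subst (asm) AE_iff_measurable[of "{b<..<b + 1}"]) auto
    then show False by simp
  qed
  then obtain x where x: "b < x" "hilbert_defined_at ?f x" by auto
  then have "set_integrable lebesgue {y. \<bar>x - y\<bar> > (x - b) / 2} (\<lambda>y. ?f y / (x - y))"
    unfolding hilbert_defined_at_def by (meson diff_gt_0_iff_gt half_gt_zero)
  moreover have "(\<lambda>y. indicator {y. \<bar>x - y\<bar> > (x - b) / 2} y *\<^sub>R (?f y / (x - y))) = (\<lambda>y. ?f y / (x - y))"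
    using x by (auto simp: fun_eq_iff split: split_indicator)
  ultimately have int: "integrable lebesgue (\<lambda>y. ?f y / (x - y))"
    unfolding set_integrable_def by simp
  \<comment> \<open>On the support \<open>(x - a) / (x - y) \<ge> 1\<close>, so \<open>K\<close>
    dominates the integral of \<open>1 / (y - a)\<close> over each \<open>{a + e..b}\<close>, which
    is \<open>ln (b - a) - ln e\<close>.\<close>
  define K where "K = (x - a) * integral\<^sup>L lebesgue (\<lambda>y. ?f y / (x - y))"
  have bound: "ln (b - a) - ln e \<le> K" if e: "0 < e" "e < b - a" for e
  proof -
    have hb: "has_bochner_integral lebesgue (\<lambda>y. indicator {a + e..b} y / (a - y)) (ln e - ln (b - a))"
      using has_bochner_integral_inverse_diff[of "a + e" b a] e assms by simp
    have "ln (b - a) - ln e = - integral\<^sup>L lebesgue (\<lambda>y. indicator {a + e..b} y / (a - y))"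
      using has_bochner_integral_integral_eq[OF hb] by simp
    also have "\<dots> = integral\<^sup>L lebesgue (\<lambda>y. - (indicator {a + e..b} y / (a - y)))" by simp
    also have "\<dots> \<le> integral\<^sup>L lebesgue (\<lambda>y. (x - a) * (?f y / (x - y)))"
    proof (rule integral_mono)
      show "integrable lebesgue (\<lambda>y. - (indicator {a + e..b} y / (a - y)))"
        using hb by (auto simp: has_bochner_integral_iff)
      show "integrable lebesgue (\<lambda>y. (x - a) * (?f y / (x - y)))" using int by (rule integrable_mult_right)
      fix y :: real
      have "1 / (y - a) \<le> (x - a) * (1 / (y - a) / (x - y))" if "a < y" "y \<le> b"
      proof -
        have "1 / (y - a) * 1 \<le> 1 / (y - a) * ((x - a) / (x - y))"
          using that x by (intro mult_left_mono) auto
        then show ?thesis by (simp add: mult_ac)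
      qed
      moreover have "- (1 / (a - y)) = 1 / (y - a)"
        by (metis minus_diff_eq minus_divide_right)
      ultimately show "- (indicator {a + e..b} y / (a - y)) \<le> (x - a) * (?f y / (x - y))"
        using e x by (auto split: split_indicator)
    qed
    also have "\<dots> = K" unfolding K_def by (rule integral_mult_right_zero)
    finally show ?thesis .
  qed
  \<comment> \<open>Chosen so that \<open>ln (b - a) - ln e = \<bar>K\<bar> + 1\<close>, which
    exceeds \<open>K\<close>.\<close>
  define e where "e = (b - a) * exp (- (\<bar>K\<bar> + 1))"
  have "exp (- (\<bar>K\<bar> + 1)) < 1" by simp
  then have "e < b - a" using assms unfolding e_def by (simp del: exp_less_one_iff)
  moreover have "0 < e" using assms by (simp add: e_def)
  moreover have "ln e = ln (b - a) - (\<bar>K\<bar> + 1)" using assms by (simp add: e_def ln_mult)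
  ultimately show False using bound[of e] by simp
qed

subsection \<open>Lorentz norms and the restricted weak-type inequality\<close>

lemma epow_mono: "x \<le> y \<Longrightarrow> 0 \<le> p \<Longrightarrow> epow x p \<le> epow y p"
  by (auto simp: epow_def top_unique intro!: ennreal_leI powr_mono2 enn2real_mono simp: less_top)

lemma umeas_mono_AE:
  "AE x in lebesgue. x \<in> A \<longrightarrow> x \<in> B \<Longrightarrow> umeas u A \<le> umeas u B"
  unfolding umeas_def by (intro nn_integral_mono_AE) (auto elim!: eventually_mono split: split_indicator)

lemma umeas_mono: "A \<subseteq> B \<Longrightarrow> umeas u A \<le> umeas u B"
  by (rule umeas_mono_AE) auto

lemma umeas_empty [simp]: "umeas u {} = 0"
  by (simp add: umeas_def)

lemma fstar_le_one:
  assumes "\<And>x. \<bar>f x\<bar> \<le> 1"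
  shows "fstar u f t \<le> 1"
proof -
  have "{x. \<bar>f x\<bar> > 1} = {}" using assms by (auto simp: not_less)
  then have "ennreal 1 \<in> {ennreal y | y. y > 0 \<and> umeas u {x. \<bar>f x\<bar> > y} \<le> ennreal t}"
    by (intro CollectI exI[of _ 1]) (simp add: less_eq_real_def)
  then have "fstar u f t \<le> ennreal 1" unfolding fstar_def by (rule Inf_lower)
  then show ?thesis by simp
qed

lemma fstar_eq_0:
  assumes "\<And>x. x \<notin> K \<Longrightarrow> f x = 0" and "umeas u K \<le> ennreal t"
  shows "fstar u f t = 0"
proof -
  have "fstar u f t \<le> 0"
  proof (rule ennreal_le_epsilon)
    fix e :: real assume e: "0 < e"
    have "{x. \<bar>f x\<bar> > e} \<subseteq> K" using assms(1) e by force
    then have "umeas u {x. \<bar>f x\<bar> > e} \<le> ennreal t"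
      using umeas_mono assms(2) order_trans by blast
    then show "fstar u f t \<le> 0 + ennreal e"
      unfolding fstar_def using e by (auto intro!: Inf_lower)
  qed
  then show ?thesis by simp
qed

lemma le_fstar:
  assumes "AE x in lebesgue. x \<in> S \<longrightarrow> l \<le> \<bar>f x\<bar>" and "ennreal t < umeas u S"
  shows "ennreal l \<le> fstar u f t"
  unfolding fstar_def
proof (rule Inf_greatest, safe)
  fix y assume y: "0 < y" "umeas u {x. y < \<bar>f x\<bar>} \<le> ennreal t"
  show "ennreal l \<le> ennreal y"
  proof (rule ccontr)
    assume "\<not> ennreal l \<le> ennreal y"
    then have "y < l" using ennreal_leI not_le by blast
    then have "umeas u S \<le> umeas u {x. y < \<bar>f x\<bar>}"
      using assms(1) by (intro umeas_mono_AE) (auto elim!: eventually_mono)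
    then show False using y(2) assms(2) by simp
  qed
qed

text \<open>The rearrangement is at most 1 and vanishes from \<open>T\<close> on, so the integrand
  is dominated by \<open>w\<close> on \<open>(0, T)\<close>.\<close>

lemma lorentz_norm_le:
  assumes "\<And>x. \<bar>f x\<bar> \<le> 1" "\<And>x. x \<notin> K \<Longrightarrow> f x = 0" "umeas u K \<le> ennreal T" "0 < p"
  shows "lorentz_norm u w p f \<le> epow (Wfun w T) (1 / p)"
  unfolding lorentz_norm_def
proof (rule epow_mono)
  show "(\<integral>\<^sup>+ t\<in>{0<..}. epow (fstar u f t) p * ennreal (w t) \<partial>lebesgue) \<le> Wfun w T"
    unfolding Wfun_def
  proof (rule nn_integral_mono)
    fix t :: real
    have "epow (fstar u f t) p \<le> epow 1 p"
      using fstar_le_one[of f u t] assms by (intro epow_mono) auto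
    also have "\<dots> = 1" by (simp add: epow_def)
    finally have "epow (fstar u f t) p * ennreal (w t) \<le> 1 * ennreal (w t)"
      by (intro mult_right_mono) auto
    moreover have "epow (fstar u f t) p = 0" if "T \<le> t"
      using fstar_eq_0[of K f u t] assms(2,3) that ennreal_leI[OF that] by (auto simp: epow_def)
    ultimately show "epow (fstar u f t) p * ennreal (w t) * indicator {0<..} t
        \<le> ennreal (w t) * indicator {0<..<T} t"
      by (auto split: split_indicator)
  qed
qed (use assms in auto)

text \<open>Here \<open>f\<close> may be unbounded. On \<open>(0, T)\<close> the weight
  \<open>w\<close> vanishes almost everywhere, and even an infinite rearrangement times 0 is 0; from
  \<open>T\<close> on the rearrangement itself vanishes.\<close>

lemma lorentz_norm_eq_0:
  assumes "w \<in> borel_measurable lebesgue"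
    and "\<And>x. x \<notin> K \<Longrightarrow> f x = 0" "umeas u K \<le> ennreal T" "Wfun w T = 0"
  shows "lorentz_norm u w p f = 0"
proof -
  have "AE t in lebesgue. ennreal (w t) * indicator {0<..<T} t = 0"
    using assms(1,4) unfolding Wfun_def
    by (subst (asm) nn_integral_0_iff_AE) (auto intro!: borel_measurable_times_ennreal borel_measurable_indicator)
  then have "AE t in lebesgue. epow (fstar u f t) p * ennreal (w t) * indicator {0<..} t = 0"
  proof eventually_elim
    case (elim t)
    have "epow (fstar u f t) p = 0" if "T \<le> t"
      using fstar_eq_0[of K f u t] assms(2,3) that ennreal_leI[OF that] by (auto simp: epow_def)
    then show ?case using elim by (cases "t < T") (auto split: split_indicator_asm split_indicator)
  qed
  then have "(\<integral>\<^sup>+ t\<in>{0<..}. epow (fstar u f t) p * ennreal (w t) \<partial>lebesgue) =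
      (\<integral>\<^sup>+ (t::real). 0 \<partial>lebesgue)"
    by (rule nn_integral_cong_AE)
  then show ?thesis by (simp add: lorentz_norm_def epow_def)
qed

section \<open>The primitive of \<open>w\<close> and the measure with density
  \<open>u\<close>\<close>

lemma Wfun_mono: "s \<le> t \<Longrightarrow> Wfun w s \<le> Wfun w t"
  unfolding Wfun_def by (intro nn_integral_mono) (auto split: split_indicator)

lemma Wfun_finite:
  assumes "weight_pos w"
  shows "Wfun w t < \<infinity>"
proof (cases "0 < t")
  case True
  then have "integrable lebesgue (\<lambda>s. indicator {0<..<t} s *\<^sub>R w s)"
    using assms by (auto simp: weight_pos_def set_integrable_def)
  then have "(\<integral>\<^sup>+ s. ennreal (norm (indicator {0<..<t} s *\<^sub>R w s)) \<partial>lebesgue) < \<infinity>"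
    by (simp add: integrable_iff_bounded)
  moreover have "Wfun w t \<le> (\<integral>\<^sup>+ s. ennreal (norm (indicator {0<..<t} s *\<^sub>R w s)) \<partial>lebesgue)"
    unfolding Wfun_def by (intro nn_integral_mono) (auto intro!: ennreal_leI split: split_indicator)
  ultimately show ?thesis by (rule order.strict_trans1[rotated])
qed (simp add: Wfun_def)

text \<open>Continuity from below of the measure with density \<open>w\<close>, along
  \<open>T - 1 / (n + 1)\<close>. It restores the endpoint that is lost because
  \<open>le_fstar\<close> needs \<open>t\<close> strictly below the measure of
  \<open>S\<close>.\<close>

lemma Wfun_left_continuous:
  assumes w: "w \<in> borel_measurable lebesgue" and B: "\<And>t. 0 < t \<Longrightarrow> t < T \<Longrightarrow> Wfun w t \<le> B"
  shows "Wfun w T \<le> B"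
proof -
  define M where "M = density lebesgue (\<lambda>s. ennreal (w s))"
  have em: "Wfun w t = emeasure M {0<..<t}" for t
    using w by (simp add: Wfun_def M_def emeasure_density)
  define t where "t n = T - 1 / real (Suc n)" for n
  have inc: "incseq (\<lambda>n. {0<..<t n})"
  proof (rule incseq_SucI)
    fix n show "{0<..<t n} \<subseteq> {0<..<t (Suc n)}"
      using frac_le[of 1 1 "real (Suc n)" "real (Suc (Suc n))"] by (auto simp: t_def)
  qed
  have lim: "t \<longlonglongrightarrow> T"
    unfolding t_def using tendsto_diff[OF tendsto_const LIMSEQ_Suc[OF lim_1_over_n], of T] by simp
  have "(\<Union>n. {0<..<t n}) = {0<..<T}"
  proof (intro equalityI subsetI)
    fix x assume x: "x \<in> {0<..<T}"
    then have "\<forall>\<^sub>F n in sequentially. x < t n" using lim by (auto intro: order_tendstoD)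
    then show "x \<in> (\<Union>n. {0<..<t n})" using x by (auto dest: eventually_happens)
  next
    fix x assume "x \<in> (\<Union>n. {0<..<t n})"
    moreover have "t n < T" for n by (simp add: t_def)
    ultimately show "x \<in> {0<..<T}" by (auto intro: less_trans)
  qed
  then have "Wfun w T = (SUP n. emeasure M {0<..<t n})"
    using SUP_emeasure_incseq[OF _ inc, of M] by (simp add: em M_def image_subset_iff)
  also have "\<dots> \<le> B"
  proof (rule SUP_least)
    fix n
    show "emeasure M {0<..<t n} \<le> B"
      using B[of "t n"] by (cases "0 < t n") (auto simp: em t_def)
  qed
  finally show ?thesis .
qed

lemma umeas_eq_emeasure:
  assumes "weight_R u" "E \<in> sets lebesgue"
  shows "umeas u E = emeasure (density lebesgue (\<lambda>x. ennreal (u x))) E"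
  using assms unfolding umeas_def weight_R_def by (subst emeasure_density) auto

lemma umeas_finite:
  assumes "weight_R u" "E \<subseteq> {a..b}"
  shows "umeas u E < \<infinity>"
proof -
  have "integrable lebesgue (\<lambda>s. indicator {a..b} s *\<^sub>R u s)"
    using assms by (auto simp: weight_R_def set_integrable_def)
  then have "(\<integral>\<^sup>+ s. ennreal (norm (indicator {a..b} s *\<^sub>R u s)) \<partial>lebesgue) < \<infinity>"
    by (simp add: integrable_iff_bounded)
  moreover have "umeas u {a..b} \<le> (\<integral>\<^sup>+ s. ennreal (norm (indicator {a..b} s *\<^sub>R u s)) \<partial>lebesgue)"
    unfolding umeas_def by (intro nn_integral_mono) (auto intro!: ennreal_leI split: split_indicator)
  ultimately show ?thesis using umeas_mono[OF assms(2), of u] by (meson le_less_trans)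
qed

text \<open>\<open>enn2real\<close> sends \<infinity> to 0, so the real values are faithful only
  where finiteness is known: for \<open>um\<close> on subsets of bounded intervals, for
  \<open>W\<close> under \<open>weight_pos\<close>.\<close>

abbreviation um :: "(real \<Rightarrow> real) \<Rightarrow> real set \<Rightarrow> real" where
  "um u E \<equiv> enn2real (umeas u E)"

abbreviation W :: "(real \<Rightarrow> real) \<Rightarrow> real \<Rightarrow> real" where
  "W w t \<equiv> enn2real (Wfun w t)"

lemma ennreal_um: "weight_R u \<Longrightarrow> E \<subseteq> {a..b} \<Longrightarrow> ennreal (um u E) = umeas u E"
  using umeas_finite[of u E a b] by simp

lemma W_mono: "weight_pos w \<Longrightarrow> s \<le> t \<Longrightarrow> W w s \<le> W w t"
  using Wfun_mono[of s t w] Wfun_finite[of w t] by (intro enn2real_mono) auto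

text \<open>Bounded functions supported in \<open>{a..b}\<close> have norm at most
  \<open>W w (um u {a..b}) powr (1 / p)\<close>, while a lower bound \<open>l\<close> on
  \<open>S\<close> gives the image weak norm at least \<open>l * W w t powr (1 / p)\<close> for
  every \<open>t\<close> below the measure of \<open>S\<close>. The \<open>p\<close>-th power of the
  boundedness inequality gives the claim.\<close>

lemma restricted_weak_type:
  assumes u: "weight_R u" and w: "weight_pos w" and p: "0 < p" and H: "hilbert_bounded u w p"
  obtains C where "0 < C"
    and "\<And>f S l a b a' b'. f \<in> borel_measurable lebesgue \<Longrightarrow> (\<forall>x. \<bar>f x\<bar> \<le> 1) \<Longrightarrow>
      (\<forall>x. x \<notin> {a..b} \<longrightarrow> f x = 0) \<Longrightarrow> S \<subseteq> {a'..b'} \<Longrightarrow>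
      (AE x in lebesgue. x \<in> S \<longrightarrow> l \<le> \<bar>hilbert f x\<bar>) \<Longrightarrow> 0 < l \<Longrightarrow>
      l powr p * W w (um u S) \<le> C * W w (um u {a..b})"
proof -
  obtain C0 where C0: "\<And>f. in_lorentz u w p f \<Longrightarrow>
      weak_lorentz_norm u w p (hilbert f) \<le> ennreal C0 * lorentz_norm u w p f"
    using H unfolding hilbert_bounded_def by blast
  \<comment> \<open>\<open>C0\<close> may be nonpositive, in which case \<open>ennreal C0\<close> is
    0; the maximum gives a positive real constant.\<close>
  define C where "C = max C0 1"
  have C: "0 < C" "C0 \<le> C" by (auto simp: C_def)
  show ?thesis
  proof (rule that[of "C powr p"])
    show "0 < C powr p" using C by simp
    fix f S l a b a' b'
    assume f: "f \<in> borel_measurable lebesgue" "\<forall>x. \<bar>f x\<bar> \<le> 1" "\<forall>x. x \<notin> {a..b} \<longrightarrow> f x = 0"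
      and S: "S \<subseteq> {a'..b'}" and ae: "AE x in lebesgue. x \<in> S \<longrightarrow> l \<le> \<bar>hilbert f x\<bar>" and l: "0 < l"
    have epW: "epow (Wfun w t) (1 / p) = ennreal (W w t powr (1 / p))" for t
      using Wfun_finite[OF w, of t] by (auto simp: epow_def)
    have norm: "lorentz_norm u w p f \<le> ennreal (W w (um u {a..b}) powr (1 / p))"
      using lorentz_norm_le[of f "{a..b}" u "um u {a..b}" p w] f p ennreal_um[OF u, of "{a..b}" a b]
      by (simp add: epW)
    then have "in_lorentz u w p f"
      unfolding in_lorentz_def using f(1) by (auto intro: le_less_trans)
    then have "weak_lorentz_norm u w p (hilbert f) \<le> ennreal C0 * lorentz_norm u w p f"
      by (rule C0)
    also have "\<dots> \<le> ennreal C * ennreal (W w (um u {a..b}) powr (1 / p))"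
      using norm C by (intro mult_mono ennreal_leI) auto
    finally have weak: "weak_lorentz_norm u w p (hilbert f)
        \<le> ennreal (C * W w (um u {a..b}) powr (1 / p))"
      using C by (simp add: ennreal_mult)
    define B where "B = C powr p * W w (um u {a..b}) / l powr p"
    have "Wfun w t \<le> ennreal B" if t: "0 < t" "t < um u S" for t
    proof -
      have "ennreal t < umeas u S"
        using t ennreal_lessI[of "um u S" t] ennreal_um[OF u S] by simp
      then have "ennreal l * ennreal (W w t powr (1 / p)) \<le>
          fstar u (hilbert f) t * epow (Wfun w t) (1 / p)"
        unfolding epW using ae by (intro mult_right_mono le_fstar) auto
      also have "\<dots> \<le> weak_lorentz_norm u w p (hilbert f)"
        unfolding weak_lorentz_norm_def using t by (intro SUP_upper) auto
      also note weak
      finally have "ennreal (l * W w t powr (1 / p)) \<le> ennreal (C * W w (um u {a..b}) powr (1 / p))"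
        using l by (simp add: ennreal_mult)
      then have "l * W w t powr (1 / p) \<le> C * W w (um u {a..b}) powr (1 / p)"
        using C by (subst (asm) ennreal_le_iff) auto
      then have "(l * W w t powr (1 / p)) powr p \<le> (C * W w (um u {a..b}) powr (1 / p)) powr p"
        using l p by (intro powr_mono2) auto
      then have "l powr p * W w t \<le> C powr p * W w (um u {a..b})"
        using l C p by (simp add: powr_mult powr_powr)
      then have "W w t \<le> B" using l by (simp add: B_def field_simps)
      then have "ennreal (W w t) \<le> ennreal B" by (rule ennreal_leI)
      then show ?thesis using Wfun_finite[OF w, of t] by simp
    qed
    then have "Wfun w (um u S) \<le> ennreal B"
      using w unfolding weight_pos_def by (elim conjE) (rule Wfun_left_continuous)
    moreover have "0 \<le> B" using C l by (simp add: B_def)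
    ultimately have "W w (um u S) \<le> B" by (rule enn2real_leI[rotated])
    then show "l powr p * W w (um u S) \<le> C powr p * W w (um u {a..b})"
      using l by (simp add: B_def field_simps)
  qed
qed

lemma W_um_interval_pos:
  assumes u: "weight_R u" and w: "weight_pos w" and p: "0 < p" and H: "hilbert_bounded u w p"
    and ab: "a < b"
  shows "0 < W w (um u {a..b})"
proof (rule ccontr)
  assume "\<not> ?thesis"
  then have "W w (um u {a..b}) = 0" by (simp add: not_less antisym)
  then have "Wfun w (um u {a..b}) = 0"
    using Wfun_finite[OF w, of "um u {a..b}"] by (auto simp: enn2real_eq_0_iff)
  moreover have "umeas u {a..b} \<le> ennreal (um u {a..b})"
    using ennreal_um[OF u, of "{a..b}" a b] by simp
  ultimately have "lorentz_norm u w p (\<lambda>y. indicator {a<..b} y / (y - a)) = 0"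
    using w by (intro lorentz_norm_eq_0[where K = "{a..b}"]) (auto simp: weight_pos_def split: split_indicator)
  moreover have "(\<lambda>y. indicator {a<..b} y / (y - a)) \<in> borel_measurable lebesgue"
    by (rule measurable_completion) measurable
  ultimately have "in_lorentz u w p (\<lambda>y. indicator {a<..b} y / (y - a))"
    by (simp add: in_lorentz_def)
  then show False
    using H not_AE_hilbert_defined_inverse[OF ab] unfolding hilbert_bounded_def by blast
qed

subsection \<open>From intervals to sparse unions of cells\<close>

lemma AE_lebesgue_not_in_finite:
  fixes F :: "real set"
  assumes "finite F"
  shows "AE x in lebesgue. x \<notin> F"
  using assms by (intro AE_not_in null_sets_completionI) (simp add: finite_imp_null_set_lborel)

lemma umeas_cong_finite_diff:
  assumes "finite F" "\<And>x. x \<notin> F \<Longrightarrow> x \<in> A \<longleftrightarrow> x \<in> B"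
  shows "umeas u A = umeas u B"
  using AE_lebesgue_not_in_finite[OF assms(1)] assms(2)
  by (intro antisym umeas_mono_AE) (auto elim!: eventually_mono)

lemma um_mono: "weight_R u \<Longrightarrow> A \<subseteq> B \<Longrightarrow> B \<subseteq> {a..b} \<Longrightarrow> um u A \<le> um u B"
  using umeas_mono[of A B u] umeas_finite[of u B a b] by (intro enn2real_mono) auto

text \<open>Half-open, so that consecutive cells tile a block without overlap. The closed and open
  intervals used elsewhere differ from them in finitely many points, which carry no
  \<open>u\<close>-measure.\<close>

definition cell :: "real \<Rightarrow> real \<Rightarrow> nat \<Rightarrow> real set" where
  "cell x h j = {x + real j * h..<x + (real j + 1) * h}"

lemma sets_cell [measurable]: "cell x h j \<in> sets lebesgue"
  by (simp add: cell_def)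

lemma disjoint_cells:
  assumes "0 \<le> h"
  shows "disjoint_family_on (cell x h) A"
proof -
  have "cell x h i \<inter> cell x h j = {}" if "i < j" for i j
  proof -
    have "(real i + 1) * h \<le> real j * h" using that assms by (intro mult_right_mono) auto
    then show ?thesis by (auto simp: cell_def)
  qed
  then show ?thesis
    unfolding disjoint_family_on_def by (metis Int_commute linorder_neqE_nat)
qed

lemma Union_cells:
  assumes "0 \<le> h"
  shows "(\<Union>j\<in>{s..<s + m}. cell x h j) = {x + real s * h..<x + (real s + real m) * h}"
proof (induction m)
  case (Suc m)
  have "(\<Union>j\<in>{s..<s + Suc m}. cell x h j) = {x + real s * h..<x + (real s + real m) * h} \<union> cell x h (s + m)"
    using Suc by (auto simp: atLeastLessThanSuc)
  also have "\<dots> = {x + real s * h..<x + (real s + real (Suc m)) * h}"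
  proof -
    have "x + real s * h \<le> x + (real s + real m) * h" "x + (real s + real m) * h \<le> x + (real s + real (Suc m)) * h"
      using assms by (auto intro: mult_right_mono)
    then show ?thesis by (auto simp: cell_def add.assoc intro: order_trans) (simp add: add_ac)+
  qed
  finally show ?case .
qed auto

lemma um_Union_cells:
  assumes u: "weight_R u" and "0 \<le> h" "finite A"
  shows "um u (\<Union>j\<in>A. cell x h j) = (\<Sum>j\<in>A. um u (cell x h j))"
proof -
  define U where "U = density lebesgue (\<lambda>x. ennreal (u x))"
  have um: "um u E = measure U E" if "E \<in> sets lebesgue" for E
    using umeas_eq_emeasure[OF u that] by (simp add: measure_def U_def)
  have fin: "emeasure U (cell x h j) \<noteq> \<infinity>" for j
  proof -
    have "cell x h j \<subseteq> {x + real j * h..x + (real j + 1) * h}" by (auto simp: cell_def)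
    from umeas_finite[OF u this] show ?thesis
      unfolding umeas_eq_emeasure[OF u sets_cell] U_def by auto
  qed
  have "measure U (\<Union>j\<in>A. cell x h j) = (\<Sum>j\<in>A. measure U (cell x h j))"
    using assms fin disjoint_cells by (intro measure_finite_Union) (auto simp: U_def)
  then show ?thesis using assms by (subst um) (auto simp: um)
qed

lemma um_block:
  assumes u: "weight_R u" and "0 \<le> h"
  shows "(\<Sum>j\<in>{s..<s + m}. um u (cell x h j)) = um u {x + real s * h..x + (real s + real m) * h}"
proof -
  have "(\<Sum>j\<in>{s..<s + m}. um u (cell x h j)) = um u {x + real s * h..<x + (real s + real m) * h}"
    using um_Union_cells[OF assms, of "{s..<s + m}" x] by (simp add: Union_cells[OF assms(2)])
  also have "umeas u {x + real s * h..<x + (real s + real m) * h} = umeas u {x + real s * h..x + (real s + real m) * h}"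
    by (rule umeas_cong_finite_diff[of "{x + (real s + real m) * h}"]) auto
  finally show ?thesis .
qed

text \<open>From here on, boundedness of the Hilbert transform enters only through
  \<open>restricted\<close> and \<open>pos\<close>.\<close>

locale hilbert_restricted =
  fixes u w :: "real \<Rightarrow> real" and p C :: real
  assumes u: "weight_R u" and w: "weight_pos w" and p: "0 < p" and C: "0 < C"
    and pos: "\<And>a b. a < b \<Longrightarrow> 0 < W w (um u {a..b})"
    and restricted: "\<And>f S l a b a' b'. f \<in> borel_measurable lebesgue \<Longrightarrow> (\<forall>x. \<bar>f x\<bar> \<le> 1) \<Longrightarrow>
      (\<forall>x. x \<notin> {a..b} \<longrightarrow> f x = 0) \<Longrightarrow> S \<subseteq> {a'..b'} \<Longrightarrow>
      (AE x in lebesgue. x \<in> S \<longrightarrow> l \<le> \<bar>hilbert f x\<bar>) \<Longrightarrow> 0 < l \<Longrightarrow>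
      l powr p * W w (um u S) \<le> C * W w (um u {a..b})"
begin

text \<open>Test with the indicator of \<open>{c..d}\<close>: the bounds on \<open>l\<close> place
  both of its ends within distance \<open>l\<close> of every point of \<open>{a..b}\<close>, so its
  Hilbert transform is at least \<open>r\<close> in modulus there.\<close>

lemma W_disjoint_intervals:
  assumes cd: "c < d" and ab: "a < b" and dis: "d \<le> a \<or> b \<le> c" and l: "b - c \<le> l" "d - a \<le> l"
  shows "W w (um u {a..b}) \<le> C * (pi * l / (d - c)) powr p * W w (um u {c..d})"
proof -
  have l0: "0 < l" using assms by auto
  define r where "r = (d - c) / (pi * l)"
  have r: "0 < r" using cd l0 by (simp add: r_def)
  have "r powr p * W w (um u {a..b}) \<le> C * W w (um u {c..d})"
  proof (rule restricted)
    show "indicator {c..d} \<in> borel_measurable lebesgue" by (intro borel_measurable_indicator) auto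
    show "AE x in lebesgue. x \<in> {a..b} \<longrightarrow> r \<le> \<bar>hilbert (indicator {c..d}) x\<bar>"
      using AE_lebesgue_not_in_finite[of "{c, d}"]
    proof (rule eventually_mono)
      fix x assume x: "x \<notin> {c, d}"
      show "x \<in> {a..b} \<longrightarrow> r \<le> \<bar>hilbert (indicator {c..d}) x\<bar>"
        unfolding r_def using x assms by (intro impI hilbert_indicator_lower_bound) auto
    qed simp
    show "{a..b} \<subseteq> {a..b}" by simp
  qed (use r in \<open>auto split: split_indicator\<close>)
  then have "W w (um u {a..b}) \<le> C * W w (um u {c..d}) / r powr p"
    using r by (simp add: field_simps)
  also have "\<dots> = C * (1 / r) powr p * W w (um u {c..d})"
    using r by (simp add: powr_divide)
  also have "1 / r = pi * l / (d - c)" by (simp add: r_def)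
  finally show ?thesis .
qed

text \<open>The first factor is the cost of passing from an interval to its right neighbour of equal
  length, the second that of passing from there to a subinterval shorter by the ratio
  \<open>\<theta>\<close>.\<close>

definition kappa :: "real \<Rightarrow> real" where
  "kappa \<theta> = C * (2 * pi) powr p * (C * (2 * pi * \<theta>) powr p)"

text \<open>Only intervals without common interior points can be compared directly, so the
  comparison goes through \<open>{b..b + l}\<close>, the right neighbour of \<open>{a..b}\<close>.
  In both comparisons all points lie within \<open>2 * l\<close> of each other.\<close>

lemma W_subinterval:
  assumes cd: "c < d" and ab: "a \<le> c" "d \<le> b" and \<theta>: "b - a \<le> \<theta> * (d - c)"
  shows "W w (um u {a..b}) \<le> kappa \<theta> * W w (um u {c..d})"
proof -
  define l where "l = b - a"
  have l: "0 < l" using cd ab by (simp add: l_def)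
  have 1: "W w (um u {a..b}) \<le> C * (pi * (2 * l) / (b + l - b)) powr p * W w (um u {b..b + l})"
    by (rule W_disjoint_intervals) (use l cd ab in \<open>auto simp: l_def\<close>)
  have 2: "W w (um u {b..b + l}) \<le> C * (pi * (2 * l) / (d - c)) powr p * W w (um u {c..d})"
    by (rule W_disjoint_intervals) (use l cd ab in \<open>auto simp: l_def\<close>)
  have "pi * (2 * l) / (d - c) \<le> 2 * pi * \<theta>"
  proof -
    have "pi * (2 * l) \<le> pi * (2 * (\<theta> * (d - c)))" using \<theta> by (simp add: l_def)
    then show ?thesis using cd by (simp add: pos_divide_le_eq mult_ac)
  qed
  then have "(pi * (2 * l) / (d - c)) powr p \<le> (2 * pi * \<theta>) powr p"
    using l cd p by (intro powr_mono2) auto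
  then have "C * (pi * (2 * l) / (d - c)) powr p * W w (um u {c..d})
      \<le> C * (2 * pi * \<theta>) powr p * W w (um u {c..d})"
    using C by (intro mult_right_mono mult_left_mono) auto
  with 2 have 3: "W w (um u {b..b + l}) \<le> C * (2 * pi * \<theta>) powr p * W w (um u {c..d})" by linarith
  have "pi * (2 * l) / (b + l - b) = 2 * pi" using l by simp
  with 1 have "W w (um u {a..b}) \<le> C * (2 * pi) powr p * W w (um u {b..b + l})" by simp
  also have "\<dots> \<le> C * (2 * pi) powr p * (C * (2 * pi * \<theta>) powr p * W w (um u {c..d}))"
    using 3 C by (intro mult_left_mono) auto
  finally show ?thesis by (simp add: kappa_def mult.assoc)
qed

text \<open>By pigeonhole one of four equal cells carries at most a quarter of the
  \<open>u\<close>-measure, and passing to it costs \<open>kappa 4\<close>. Comparing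
  \<open>W\<close> at two different arguments is what later turns a bound on \<open>W\<close> into a
  bound on the \<open>u\<close>-measure.\<close>

lemma W_quarter:
  assumes "a < b"
  shows "W w (um u {a..b}) \<le> kappa 4 * W w (um u {a..b} / 4)"
proof -
  define h where "h = (b - a) / 4"
  have h: "0 < h" using assms by (simp add: h_def)
  have sum: "(\<Sum>j<4::nat. um u (cell a h j)) = um u {a..b}"
  proof -
    have "a + 4 * h = b" by (simp add: h_def field_simps)
    then show ?thesis using um_block[OF u, of h a 0 4] h by (simp add: atLeast0LessThan)
  qed
  have "\<exists>j<4::nat. um u (cell a h j) \<le> um u {a..b} / 4"
  proof (rule ccontr)
    assume "\<not> ?thesis"
    then have "(\<Sum>j<4::nat. um u {a..b} / 4) < (\<Sum>j<4::nat. um u (cell a h j))"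
      by (intro sum_strict_mono) (auto simp: not_le lessThan_empty_iff)
    then show False by (simp add: sum)
  qed
  then obtain j :: nat where j: "j < 4" "um u (cell a h j) \<le> um u {a..b} / 4" by blast
  have cell: "um u (cell a h j) = um u {a + real j * h..a + (real j + 1) * h}"
    using um_block[OF u, of h a j 1] h by simp
  have "(real j + 1) * h \<le> 4 * h" using j h by (intro mult_right_mono) auto
  then have "W w (um u {a..b}) \<le> kappa 4 * W w (um u {a + real j * h..a + (real j + 1) * h})"
  proof (intro W_subinterval)
    have "4 * h = b - a" by (simp add: h_def)
    moreover have "a + (real j + 1) * h - (a + real j * h) = h" by (simp add: distrib_right)
    ultimately show "b - a \<le> 4 * (a + (real j + 1) * h - (a + real j * h))" by simp
    show "a + (real j + 1) * h \<le> b"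
      using \<open>4 * h = b - a\<close> \<open>(real j + 1) * h \<le> 4 * h\<close> by linarith
  qed (use h in auto)
  also have "\<dots> \<le> kappa 4 * W w (um u {a..b} / 4)"
    using j(2) C unfolding cell by (intro mult_left_mono W_mono w) (auto simp: kappa_def)
  finally show ?thesis .
qed

text \<open>The test function lives on \<open>{lo..2 * hi - lo}\<close>, twice as long as
  \<open>{lo..hi}\<close>; \<open>kappa 2\<close> is the price of returning to
  \<open>{lo..hi}\<close>.\<close>

lemma W_separated_union:
  fixes c d :: "nat \<Rightarrow> real"
  assumes cd: "\<And>i. i < n \<Longrightarrow> c i < d i"
    and sep: "\<And>i j. i < j \<Longrightarrow> j < n \<Longrightarrow> d i < c j"
    and sub: "\<And>i. i < n \<Longrightarrow> lo \<le> c i \<and> d i \<le> hi"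
    and M: "2 \<le> M" and small: "M * (\<Sum>i<n. d i - c i) \<le> hi - lo"
    and lohi: "lo < hi"
  shows "(ln M / pi) powr p * W w (um u (\<Union>i<n. {c i<..<d i})) \<le> C * kappa 2 * W w (um u {lo..hi})"
proof -
  show ?thesis
  proof (rule interlacing_log_quotient[OF cd sep sub M small lohi])
    fix a b assume
      ab: "\<And>i. i < n \<Longrightarrow> lo \<le> b i \<and> b i < a i \<and> a i \<le> 2 * hi - lo"
      and dis: "\<And>i j. i < j \<Longrightarrow> j < n \<Longrightarrow> a i < b j"
      and big: "\<And>i x. i < n \<Longrightarrow> c i < x \<Longrightarrow> x < d i \<Longrightarrow> (\<And>j. j < n \<Longrightarrow> x \<noteq> b j \<and> x \<noteq> a j) \<Longrightarrow>
        ln M \<le> \<bar>\<Sum>j<n. ln \<bar>x - b j\<bar> - ln \<bar>x - a j\<bar>\<bar>"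
    define f where "f = (\<lambda>y. \<Sum>i<n. indicator {b i..a i} y :: real)"
    \<comment> \<open>Disjointness makes the sum of indicators an indicator, hence bounded by 1 as
      \<open>restricted\<close> requires.\<close>
    have "disjoint_family_on (\<lambda>i. {b i..a i}) {..<n}"
      unfolding disjoint_family_on_def
    proof (intro ballI impI)
      fix i j assume ij: "i \<in> {..<n}" "j \<in> {..<n}" "i \<noteq> j"
      then show "{b i..a i} \<inter> {b j..a j} = {}"
        using dis[of i j] dis[of j i] by (cases "i < j") auto
    qed
    then have f: "f = indicator (\<Union>i<n. {b i..a i})"
      unfolding f_def by (intro ext) (simp add: indicator_UN_disjoint)
    have "(ln M / pi) powr p * W w (um u (\<Union>i<n. {c i<..<d i})) \<le> C * W w (um u {lo..2 * hi - lo})"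
    proof (rule restricted)
      show "f \<in> borel_measurable lebesgue" unfolding f by (intro borel_measurable_indicator) auto
      show "\<forall>x. \<bar>f x\<bar> \<le> 1" by (simp add: f indicator_def)
      show "\<forall>x. x \<notin> {lo..2 * hi - lo} \<longrightarrow> f x = 0"
        using ab by (force simp: f indicator_def)
      show "(\<Union>i<n. {c i<..<d i}) \<subseteq> {lo..hi}" using sub by force
      show "0 < ln M / pi" using M by simp
      show "AE x in lebesgue. x \<in> (\<Union>i<n. {c i<..<d i}) \<longrightarrow> ln M / pi \<le> \<bar>hilbert f x\<bar>"
        using AE_lebesgue_not_in_finite[of "b ` {..<n} \<union> a ` {..<n}"]
      proof (rule eventually_mono)
        fix x assume x: "x \<notin> b ` {..<n} \<union> a ` {..<n}"
        then have nz: "\<And>j. j < n \<Longrightarrow> x \<noteq> b j \<and> x \<noteq> a j" by auto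
        have "hilbert f x = (\<Sum>i<n. ln \<bar>x - b i\<bar> - ln \<bar>x - a i\<bar>) / pi"
          unfolding f_def using ab nz by (intro hilbert_sum_indicator) auto
        then show "x \<in> (\<Union>i<n. {c i<..<d i}) \<longrightarrow> ln M / pi \<le> \<bar>hilbert f x\<bar>"
          using big[OF _ _ _ nz] by (auto intro!: divide_right_mono)
      qed simp
    qed
    also have "\<dots> \<le> C * (kappa 2 * W w (um u {lo..hi}))"
      using lohi C by (intro mult_left_mono W_subinterval) auto
    finally show ?thesis by (simp add: mult.assoc)
  qed
qed

text \<open>If the union \<open>S\<close> had more than a quarter of the measure of
  \<open>I\<close>, then \<open>W_quarter\<close> would bound \<open>W\<close> at \<open>I\<close>
  by \<open>kappa 4\<close> times \<open>W\<close> at \<open>S\<close>.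
  \<open>W_separated_union\<close> bounds \<open>W\<close> at \<open>S\<close> by a small multiple
  of \<open>W\<close> at \<open>I\<close>, and together these force \<open>W\<close> to vanish at
  \<open>I\<close>, against \<open>pos\<close>.\<close>

lemma um_separated_union:
  obtains M where "2 \<le> M"
    and "\<And>(c :: nat \<Rightarrow> real) d n lo hi. (\<And>i. i < n \<Longrightarrow> c i < d i) \<Longrightarrow>
      (\<And>i j. i < j \<Longrightarrow> j < n \<Longrightarrow> d i < c j) \<Longrightarrow>
      (\<And>i. i < n \<Longrightarrow> lo \<le> c i \<and> d i \<le> hi) \<Longrightarrow>
      M * (\<Sum>i<n. d i - c i) \<le> hi - lo \<Longrightarrow> lo < hi \<Longrightarrow>
      um u (\<Union>i<n. {c i<..<d i}) \<le> um u {lo..hi} / 4"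
proof -
  \<comment> \<open>The summand 1 remains after absorbing \<open>C * kappa 2 * kappa 4\<close>, and
    \<open>M\<close> below is taken so large that \<open>(ln M / pi) powr p \<ge> k\<close>.\<close>
  define k where "k = C * kappa 2 * kappa 4 + 1"
  have "0 \<le> kappa \<theta>" for \<theta> using C by (simp add: kappa_def)
  then have k: "0 < k" using C by (simp add: k_def add_nonneg_pos)
  define M where "M = max 2 (exp (pi * k powr (1 / p)))"
  have M: "2 \<le> M" by (simp add: M_def)
  have "pi * k powr (1 / p) \<le> ln M" using M by (subst ln_ge_iff) (auto simp: M_def)
  then have "k powr (1 / p) \<le> ln M / pi" by (simp add: field_simps)
  then have "(k powr (1 / p)) powr p \<le> (ln M / pi) powr p"
    using p by (intro powr_mono2) auto
  then have kM: "k \<le> (ln M / pi) powr p" using k p by (simp add: powr_powr)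
  show ?thesis
  proof (rule that[OF M])
    fix c d :: "nat \<Rightarrow> real" and n lo hi
    assume cd: "\<And>i. i < n \<Longrightarrow> c i < d i" and sep: "\<And>i j. i < j \<Longrightarrow> j < n \<Longrightarrow> d i < c j"
      and sub: "\<And>i. i < n \<Longrightarrow> lo \<le> c i \<and> d i \<le> hi"
      and small: "M * (\<Sum>i<n. d i - c i) \<le> hi - lo" and lohi: "lo < hi"
    let ?S = "\<Union>i<n. {c i<..<d i}" and ?I = "um u {lo..hi}"
    show "um u ?S \<le> ?I / 4"
    proof (rule ccontr)
      assume "\<not> um u ?S \<le> ?I / 4"
      then have "W w (?I / 4) \<le> W w (um u ?S)" by (intro W_mono w) auto
      then have "kappa 4 * W w (?I / 4) \<le> kappa 4 * W w (um u ?S)"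
        using \<open>0 \<le> kappa 4\<close> by (rule mult_left_mono)
      then have 1: "W w ?I \<le> kappa 4 * W w (um u ?S)" using W_quarter[OF lohi] by linarith
      have "k * W w (um u ?S) \<le> (ln M / pi) powr p * W w (um u ?S)"
        using kM by (rule mult_right_mono) simp
      also have "\<dots> \<le> C * kappa 2 * W w ?I"
        by (rule W_separated_union[OF cd sep sub M small lohi])
      also have "\<dots> \<le> C * kappa 2 * (kappa 4 * W w (um u ?S))"
        using 1 C \<open>0 \<le> kappa 2\<close> by (intro mult_left_mono) auto
      finally have "W w (um u ?S) \<le> 0" by (simp add: k_def algebra_simps)
      then have "kappa 4 * W w (um u ?S) \<le> 0" using \<open>0 \<le> kappa 4\<close> by (simp add: mult_le_0_iff)
      then show False using 1 pos[OF lohi] by linarith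
    qed
  qed
qed

text \<open>With \<open>\<eta> = 1 / M\<close>, at most \<open>\<eta> * m\<close> cells out of
  \<open>m\<close> are sparse enough for the quarter bound, applied to two subfamilies. Since
  \<open>M\<close> serves all intervals, \<open>\<eta>\<close> does not depend on the grid or the
  block, so the bound can be used at every dyadic scale.\<close>

lemma sum_cells_half:
  obtains \<eta> where "0 < \<eta>" "\<eta> < 1"
    and "\<And>x h s m A. 0 < h \<Longrightarrow> A \<subseteq> {s..<s + m} \<Longrightarrow> real (card A) \<le> \<eta> * real m \<Longrightarrow>
      (\<Sum>j\<in>A. um u (cell x h j)) \<le> (\<Sum>j\<in>{s..<s + m}. um u (cell x h j)) / 2"
proof -
  show ?thesis
  proof (rule um_separated_union)
    fix M :: real assume M: "2 \<le> M"
      and quarter: "\<And>(c :: nat \<Rightarrow> real) d n lo hi. (\<And>i. i < n \<Longrightarrow> c i < d i) \<Longrightarrow>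
        (\<And>i j. i < j \<Longrightarrow> j < n \<Longrightarrow> d i < c j) \<Longrightarrow>
        (\<And>i. i < n \<Longrightarrow> lo \<le> c i \<and> d i \<le> hi) \<Longrightarrow>
        M * (\<Sum>i<n. d i - c i) \<le> hi - lo \<Longrightarrow> lo < hi \<Longrightarrow>
        um u (\<Union>i<n. {c i<..<d i}) \<le> um u {lo..hi} / 4"
    show ?thesis
    proof (rule that[of "1 / M"])
      show "0 < 1 / M" "1 / M < 1" using M by auto
      fix x h :: real and s m A
      assume h: "0 < h" and A: "A \<subseteq> {s..<s + m}" and card: "real (card A) \<le> 1 / M * real m"
      let ?v = "\<lambda>j. um u (cell x h j)"
      have "finite A" using finite_subset[OF A] by simp
      have sparse: "sum ?v B \<le> sum ?v {s..<s + m} / 4" if "B \<subseteq> A" "\<And>j. j \<in> B \<Longrightarrow> Suc j \<notin> B" for B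
      proof (cases "B = {}")
        case True
        then show ?thesis by (auto intro: sum_nonneg)
      next
        case False
        have fin: "finite A" "finite B" using \<open>finite A\<close> finite_subset[OF that(1)] by auto
        define n where "n = card B"
        define r where "r i = sorted_list_of_set B ! i" for i
        have rB: "r ` {..<n} = B"
          using set_sorted_list_of_set[OF fin(2)] unfolding set_conv_nth r_def n_def by auto
        have mono: "r i < r j" if "i < j" "j < n" for i j
          using that strict_sorted_list_of_set[of B] unfolding r_def n_def
          by (simp add: sorted_wrt_iff_nth_less)
        have mem: "r i \<in> B" if "i < n" for i using rB that by auto
        \<comment> \<open>As \<open>B\<close> has no two consecutive indices, its increasing
          enumeration skips at least one cell each time; this gives the strict separation of the
          intervals.\<close>
        have gap: "Suc (r i) < r j" if "i < j" "j < n" for i j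
          using mono[OF that] mem[of i] mem[of j] \<open>\<And>j. j \<in> B \<Longrightarrow> Suc j \<notin> B\<close>[of "r i"] that
          by (cases "Suc (r i) = r j") auto
        have m: "0 < m" using False that(1) A by (cases m) auto
        let ?c = "\<lambda>i. x + real (r i) * h" and ?d = "\<lambda>i. x + (real (r i) + 1) * h"
        have "um u (\<Union>i<n. {?c i<..<?d i}) \<le> um u {x + real s * h..x + (real s + real m) * h} / 4"
        proof (rule quarter)
          show "?c i < ?d i" for i using h by simp
          show "?d i < ?c j" if "i < j" "j < n" for i j
          proof -
            have "(real (r i) + 1) * h < real (r j) * h"
              using gap[OF that] h by (intro mult_strict_right_mono) auto
            then show ?thesis by simp
          qed
          show "x + real s * h \<le> ?c i \<and> ?d i \<le> x + (real s + real m) * h" if "i < n" for i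
          proof -
            have "s \<le> r i" "Suc (r i) \<le> s + m" using mem[OF that] \<open>B \<subseteq> A\<close> A by force+
            then have "real s * h \<le> r i * h" "(real (r i) + 1) * h \<le> (real s + real m) * h"
              using h by (intro mult_right_mono; simp)+
            then show ?thesis by simp
          qed
          have "(\<Sum>i<n. ?d i - ?c i) = real n * h" by (simp add: algebra_simps)
          moreover have "real n \<le> 1 / M * real m"
            using card card_mono[OF fin(1) that(1)] by (simp add: n_def)
          then have "M * real n \<le> real m" using M by (simp add: field_simps)
          then have "M * real n * h \<le> real m * h" using h by (intro mult_right_mono) auto
          ultimately show "M * (\<Sum>i<n. ?d i - ?c i) \<le> x + (real s + real m) * h - (x + real s * h)"
            by (simp add: algebra_simps)
          show "x + real s * h < x + (real s + real m) * h" using h m by simp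
        qed
        also have "\<dots> = sum ?v {s..<s + m} / 4" using um_block[OF u, of h x s m] h by simp
        finally have "um u (\<Union>i<n. {?c i<..<?d i}) \<le> sum ?v {s..<s + m} / 4" .
        moreover have "umeas u (\<Union>i<n. {?c i<..<?d i}) = umeas u (\<Union>j\<in>B. cell x h j)"
          unfolding rB[symmetric]
        proof (rule umeas_cong_finite_diff[of "?c ` {..<n}"])
          show "x' \<in> (\<Union>i<n. {?c i<..<?d i}) \<longleftrightarrow> x' \<in> (\<Union>j\<in>r ` {..<n}. cell x h j)"
            if "x' \<notin> ?c ` {..<n}" for x'
            using that by (auto simp: cell_def less_le)
        qed simp
        moreover have "um u (\<Union>j\<in>B. cell x h j) = sum ?v B"
          using um_Union_cells[OF u, of h B x] h fin by simp
        ultimately show ?thesis by simp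
      qed
      \<comment> \<open>Cells of equal parity do not touch, as the interlacing argument requires.\<close>
      have "sum ?v A = sum ?v {j\<in>A. even j} + sum ?v {j\<in>A. odd j}"
        using \<open>finite A\<close> by (subst sum.union_disjoint[symmetric]) (auto intro: sum.cong)
      also have "\<dots> \<le> sum ?v {s..<s + m} / 4 + sum ?v {s..<s + m} / 4"
        by (intro add_mono sparse) auto
      finally show "sum ?v A \<le> sum ?v {s..<s + m} / 2" by simp
    qed
  qed
qed

end

subsection \<open>Power decay along dyadic generations\<close>

text \<open>
  \<open>B\<close> is the union of the maximal dyadic blocks in which \<open>A\<close> has density above \<open>\<eta> / 2\<close>: since the parent
  of such a block is not selected, \<open>A\<close> still has density at most \<open>\<eta>\<close> in the block itself.
\<close>

lemma dyadic_enlargement: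
  fixes v :: "nat \<Rightarrow> real"
  assumes \<eta>: "0 < \<eta>" "\<eta> < 1"
    and half: "\<And>s m A. A \<subseteq> {s..<s + m} \<Longrightarrow> real (card A) \<le> \<eta> * m \<Longrightarrow>
        sum v A \<le> sum v {s..<s + m} / 2"
    and A: "A \<subseteq> {s..<s + 2 ^ N}" "real (card A) \<le> \<eta> / 2 * 2 ^ N"
  shows "\<exists>B. A \<subseteq> B \<and> B \<subseteq> {s..<s + 2 ^ N} \<and> real (card B) \<le> 2 / \<eta> * card A \<and>
           sum v A \<le> sum v B / 2"
  using A
proof (induction N arbitrary: s A)
  case 0
  \<comment> \<open>A block with one index: \<open>\<eta> / 2 < 1\<close> leaves no room for an
    element.\<close>
  then have "real (card A) < 1" using \<eta> by simp
  moreover have "finite A" using 0 finite_subset by blast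
  ultimately have "A = {}" by simp
  then show ?case by auto
next
  case (Suc N)
  have step: "\<exists>B. A \<inter> {t..<t + 2 ^ N} \<subseteq> B \<and> B \<subseteq> {t..<t + 2 ^ N} \<and>
      real (card B) \<le> 2 / \<eta> * card (A \<inter> {t..<t + 2 ^ N}) \<and>
      sum v (A \<inter> {t..<t + 2 ^ N}) \<le> sum v B / 2" for t
  proof (cases "real (card (A \<inter> {t..<t + 2 ^ N})) \<le> \<eta> / 2 * 2 ^ N")
    case True
    then show ?thesis by (intro Suc.IH) auto
  next
    case False
    have "card (A \<inter> {t..<t + 2 ^ N}) \<le> card A"
      using Suc.prems(1) finite_subset by (intro card_mono) blast+
    then have "real (card (A \<inter> {t..<t + 2 ^ N})) \<le> \<eta> * (2 ^ N :: nat)"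
      using Suc.prems(2) by simp
    then have "sum v (A \<inter> {t..<t + 2 ^ N}) \<le> sum v {t..<t + 2 ^ N} / 2"
      by (intro half) auto
    moreover have "real (card {t..<t + 2 ^ N}) \<le> 2 / \<eta> * card (A \<inter> {t..<t + 2 ^ N})"
      using False \<eta> by (simp add: field_simps)
    ultimately show ?thesis by blast
  qed
  define L R where "L = {s..<s + 2 ^ N}" and "R = {s + 2 ^ N..<s + 2 ^ N + 2 ^ N}"
  have LR: "{s..<s + 2 ^ Suc N} = L \<union> R" "L \<inter> R = {}" "finite L" "finite R"
    by (auto simp: L_def R_def)
  obtain B1 where B1: "A \<inter> L \<subseteq> B1" "B1 \<subseteq> L" "real (card B1) \<le> 2 / \<eta> * card (A \<inter> L)"
    "sum v (A \<inter> L) \<le> sum v B1 / 2"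
    using step[of s] unfolding L_def by blast
  obtain B2 where B2: "A \<inter> R \<subseteq> B2" "B2 \<subseteq> R" "real (card B2) \<le> 2 / \<eta> * card (A \<inter> R)"
    "sum v (A \<inter> R) \<le> sum v B2 / 2"
    using step[of "s + 2 ^ N"] unfolding R_def by blast
  have fin: "finite B1" "finite B2" "B1 \<inter> B2 = {}"
    using B1(2) B2(2) LR finite_subset by blast+
  have A: "A = (A \<inter> L) \<union> (A \<inter> R)" "(A \<inter> L) \<inter> (A \<inter> R) = {}"
    using Suc.prems LR by blast+
  have cA: "card A = card (A \<inter> L) + card (A \<inter> R)"
    using A LR by (metis card_Un_disjoint finite_Int)
  have vA: "sum v A = sum v (A \<inter> L) + sum v (A \<inter> R)"
    using A LR by (metis sum.union_disjoint finite_Int)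
  have "real (card (B1 \<union> B2)) \<le> 2 / \<eta> * card A"
    using fin B1(3) B2(3) by (simp add: card_Un_disjoint cA distrib_left)
  moreover have "sum v A \<le> sum v (B1 \<union> B2) / 2"
    using fin B1(4) B2(4) by (simp add: sum.union_disjoint vA)
  moreover have "A \<subseteq> B1 \<union> B2" "B1 \<union> B2 \<subseteq> {s..<s + 2 ^ Suc N}"
    using A B1 B2 LR by blast+
  ultimately show ?case by blast
qed

text \<open>Each enlargement at least doubles the mass and raises the cardinality by a factor of at
  most \<open>2 / \<eta>\<close>, so density \<open>(\<eta> / 2) ^ k\<close> allows \<open>k\<close>
  enlargements inside the block.\<close>

lemma dyadic_geometric_decay:
  fixes v :: "nat \<Rightarrow> real"
  assumes \<eta>: "0 < \<eta>" "\<eta> < 1" and v: "\<And>j. 0 \<le> v j"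
    and half: "\<And>s m A. A \<subseteq> {s..<s + m} \<Longrightarrow> real (card A) \<le> \<eta> * m \<Longrightarrow>
        sum v A \<le> sum v {s..<s + m} / 2"
    and A: "A \<subseteq> {..<2 ^ N}" "real (card A) \<le> (\<eta> / 2) ^ k * 2 ^ N"
  shows "sum v A \<le> (1 / 2) ^ k * sum v {..<2 ^ N}"
  using A
proof (induction k arbitrary: A)
  case 0
  then show ?case using v by (auto intro: sum_mono2)
next
  case (Suc k)
  have "(\<eta> / 2) ^ k \<le> 1" using \<eta> by (intro power_le_one) auto
  then have "(\<eta> / 2) ^ Suc k * 2 ^ N \<le> \<eta> / 2 * 2 ^ N"
    using \<eta> by (intro mult_right_mono) (auto simp: mult_left_le)
  then have "real (card A) \<le> \<eta> / 2 * 2 ^ N" using Suc.prems by linarith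
  then obtain B where B: "B \<subseteq> {..<2 ^ N}" "real (card B) \<le> 2 / \<eta> * card A" "sum v A \<le> sum v B / 2"
    using dyadic_enlargement[OF \<eta> half, of A 0 N] Suc.prems by (auto simp: atLeast0LessThan)
  have "2 / \<eta> * card A \<le> 2 / \<eta> * ((\<eta> / 2) ^ Suc k * 2 ^ N)"
    using \<eta> Suc.prems(2) by (intro mult_left_mono) auto
  also have "\<dots> = (\<eta> / 2) ^ k * 2 ^ N" using \<eta> by simp
  finally have "sum v B \<le> (1 / 2) ^ k * sum v {..<2 ^ N}"
    using B by (intro Suc.IH) auto
  then show ?case using B(3) by simp
qed

text \<open>The exponent \<open>\<delta> = ln 2 / ln (2 / \<eta>)\<close> solves
  \<open>(\<eta> / 2) powr \<delta> = 1 / 2\<close>, which turns the geometric decay into a power of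
  the density.\<close>

lemma dyadic_power_decay:
  fixes v :: "nat \<Rightarrow> real"
  assumes \<eta>: "0 < \<eta>" "\<eta> < 1" and v: "\<And>j. 0 \<le> v j"
    and half: "\<And>s m A. A \<subseteq> {s..<s + m} \<Longrightarrow> real (card A) \<le> \<eta> * m \<Longrightarrow>
        sum v A \<le> sum v {s..<s + m} / 2"
    and A: "A \<subseteq> {..<2 ^ N}"
  shows "sum v A \<le> 2 * (card A / 2 ^ N) powr (ln 2 / ln (2 / \<eta>)) * sum v {..<2 ^ N}"
proof (cases "A = {}")
  case False
  define r where "r = real (card A) / 2 ^ N"
  have "finite A" using A finite_subset by blast
  then have r0: "0 < r" using False by (simp add: r_def card_gt_0_iff)
  have "card A \<le> 2 ^ N" using card_mono[OF _ A] by simp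
  then have r1: "r \<le> 1" by (simp add: r_def flip: of_nat_power)
  define l where "l = ln (2 / \<eta>)"
  have l: "0 < l" unfolding l_def using \<eta> by simp
  \<comment> \<open>The largest \<open>k\<close> with \<open>r \<le> (\<eta> / 2) ^ k\<close>.
    Rounding down loses less than one generation, which is the factor 2 in the bound.\<close>
  define k where "k = nat \<lfloor>- ln r / l\<rfloor>"
  have q: "0 \<le> - ln r / l" using r0 r1 l by (intro divide_nonneg_pos) auto
  have k1: "real k \<le> - ln r / l" and k2: "- ln r / l < real k + 1"
    unfolding k_def using q by linarith+
  have "ln r \<le> - (k * l)" using k1 l by (simp add: field_simps)
  then have "r \<le> exp (- (k * l))" using r0 by (simp add: ln_ge_iff[symmetric] ln_le_cancel_iff[symmetric])
  also have "\<dots> = (\<eta> / 2) ^ k"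
    using \<eta> by (simp add: l_def exp_minus exp_of_nat_mult power_divide field_simps)
  finally have "real (card A) \<le> (\<eta> / 2) ^ k * 2 ^ N" by (simp add: r_def field_simps)
  from dyadic_geometric_decay[OF \<eta> v half A this]
  have "sum v A \<le> (1 / 2) ^ k * sum v {..<2 ^ N}" .
  also have "\<dots> \<le> (2 * r powr (ln 2 / l)) * sum v {..<2 ^ N}"
  proof (rule mult_right_mono)
    have "(1 / 2 :: real) ^ k = exp (- (k * ln 2))"
      by (simp add: exp_minus exp_of_nat_mult power_divide field_simps)
    also have "\<dots> \<le> exp (ln 2 + ln r * (ln 2 / l))"
    proof -
      have "- ln r / l * ln 2 \<le> (real k + 1) * ln 2"
        using k2 by (intro mult_right_mono) auto
      then show ?thesis by (simp add: algebra_simps)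
    qed
    also have "\<dots> = 2 * r powr (ln 2 / l)" using r0 by (simp add: exp_add powr_def mult.commute)
    finally show "(1 / 2) ^ k \<le> 2 * r powr (ln 2 / l)" .
  qed (use v in \<open>auto intro: sum_nonneg\<close>)
  finally show ?thesis by (simp add: r_def l_def)
qed auto

text \<open>Up to the null point \<open>b\<close>, which no cell contains, \<open>T\<close> inside
  \<open>{a..b}\<close> is covered by the dyadic cells contained in \<open>T\<close>. The unions
  \<open>S N\<close> increase because a cell splits into two cells of the next generation, so the
  bound passes to the limit by continuity from below.\<close>

lemma um_le_of_dyadic_bound:
  assumes u: "weight_R u" and ab: "a < b" and T: "open T" and B: "0 \<le> B"
    and dyadic: "\<And>N A. A \<subseteq> {..<2 ^ N} \<Longrightarrow> (\<Union>j\<in>A. cell a ((b - a) / 2 ^ N) j) \<subseteq> T \<Longrightarrow>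
      um u (\<Union>j\<in>A. cell a ((b - a) / 2 ^ N) j) \<le> B"
  shows "um u (T \<inter> {a..b}) \<le> B"
proof -
  define h where "h N = (b - a) / 2 ^ N" for N
  define S where "S N = (\<Union>j\<in>{j. j < 2 ^ N \<and> cell a (h N) j \<subseteq> T}. cell a (h N) j)" for N
  define U where "U = density lebesgue (\<lambda>x. ennreal (u x))"
  have h: "0 < h N" "h N = 2 * h (Suc N)" "2 ^ N * h N = b - a" for N
    using ab by (auto simp: h_def field_simps)
  have S_sets: "S N \<in> sets lebesgue" for N
    unfolding S_def by (intro sets.finite_UN) auto
  have S_sub: "S N \<subseteq> {a..b}" for N
  proof -
    have "S N \<subseteq> (\<Union>j\<in>{0..<0 + 2 ^ N}. cell a (h N) j)" by (auto simp: S_def)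
    also have "\<dots> \<subseteq> {a..b}"
      using Union_cells[of "h N" a 0 "2 ^ N"] h(1,3)[of N] by auto
    finally show ?thesis .
  qed
  have "incseq S"
  proof (rule incseq_SucI, rule subsetI)
    fix N y assume "y \<in> S N"
    then obtain j where j: "j < 2 ^ N" "cell a (h N) j \<subseteq> T" "y \<in> cell a (h N) j"
      by (auto simp: S_def)
    have split: "cell a (h N) j = cell a (h (Suc N)) (2 * j) \<union> cell a (h (Suc N)) (2 * j + 1)"
      using h(1)[of "Suc N"] by (auto simp: cell_def h(2)[of N] algebra_simps)
    then obtain i where i: "i = 2 * j \<or> i = 2 * j + 1" "y \<in> cell a (h (Suc N)) i"
      "cell a (h (Suc N)) i \<subseteq> T"
      using j(2,3) by blast
    have "i < 2 ^ Suc N" using i(1) j(1) by auto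
    then show "y \<in> S (Suc N)" using i(2,3) unfolding S_def by blast
  qed
  have cover: "y \<in> (\<Union>N. S N)" if y: "y \<in> T" "a \<le> y" "y < b" for y
  proof -
    obtain e where e: "0 < e" "\<And>z. dist z y < e \<Longrightarrow> z \<in> T"
      using T y(1) by (metis open_dist)
    obtain N where N: "(1 / 2) ^ N < e / (b - a)"
      using real_arch_pow_inv[of "e / (b - a)" "1 / 2"] e ab by auto
    then have hN: "h N < e" using ab by (simp add: h_def field_simps)
    define j where "j = nat \<lfloor>(y - a) / h N\<rfloor>"
    have q: "0 \<le> (y - a) / h N" using y h(1)[of N] by simp
    then have "real j \<le> (y - a) / h N" "(y - a) / h N < real j + 1"
      unfolding j_def by linarith+
    then have j: "real j * h N \<le> y - a" "y - a < (real j + 1) * h N"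
      using h(1)[of N] by (auto simp: field_simps)
    have "real j * h N < 2 ^ N * h N" using j(1) y h(3)[of N] by linarith
    then have "real j < 2 ^ N" using h(1)[of N] by simp
    then have "real j < real (2 ^ N)" by simp
    then have jN: "j < 2 ^ N" by (simp only: of_nat_less_iff)
    have "cell a (h N) j \<subseteq> T"
    proof
      fix z assume "z \<in> cell a (h N) j"
      then have "\<bar>z - y\<bar> < h N" using j by (auto simp: cell_def distrib_right)
      then show "z \<in> T" using e(2)[of z] hN by (simp add: dist_real_def)
    qed
    moreover have "y \<in> cell a (h N) j" using j by (auto simp: cell_def)
    ultimately show ?thesis using jN by (auto simp: S_def)
  qed
  have "umeas u (T \<inter> {a..b}) \<le> umeas u (\<Union>N. S N)"
    using AE_lebesgue_not_in_finite[of "{b}"] cover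
    by (intro umeas_mono_AE) (auto elim!: eventually_mono)
  also have "\<dots> = emeasure U (\<Union>N. S N)"
    unfolding U_def using S_sets by (intro umeas_eq_emeasure u) auto
  also have "\<dots> = (SUP N. emeasure U (S N))"
    using S_sets \<open>incseq S\<close> by (intro SUP_emeasure_incseq[symmetric]) (auto simp: U_def)
  also have "\<dots> \<le> ennreal B"
  proof (rule SUP_least)
    fix N
    have "um u (S N) \<le> B"
      unfolding S_def h_def by (rule dyadic) auto
    then have "ennreal (um u (S N)) \<le> ennreal B" by (rule ennreal_leI)
    then show "emeasure U (S N) \<le> ennreal B"
      using ennreal_um[OF u S_sub[of N]] umeas_eq_emeasure[OF u S_sets[of N]] by (simp add: U_def)
  qed
  finally show ?thesis using B by (rule enn2real_leI[rotated])
qed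

lemma measure_Union_cells:
  fixes h :: real
  assumes "0 \<le> h" "finite A"
  shows "measure lebesgue (\<Union>j\<in>A. cell x h j) = card A * h"
proof -
  have fin: "emeasure lebesgue (cell x h j) \<noteq> \<infinity>" for j
    using assms(1) by (simp add: cell_def mult_right_mono)
  have "measure lebesgue (\<Union>j\<in>A. cell x h j) = (\<Sum>j\<in>A. measure lebesgue (cell x h j))"
    using assms by (intro measure_finite_Union disjoint_cells) (use fin in auto)
  also have "\<dots> = card A * h"
    using assms by (simp add: cell_def distrib_right)
  finally show ?thesis .
qed

section \<open>The power bound for measurable sets\<close>

context hilbert_restricted
begin

text \<open>Enclose \<open>E\<close> in an open set of at most twice its measure and count the
  dyadic cells inside it; the doubling costs the factor \<open>2 powr \<delta>\<close>. The exponent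
  is below 1 because \<open>2 / \<eta> > 2\<close>.\<close>

lemma A_infty_u: "A_infty u"
proof (rule sum_cells_half)
  fix \<eta> :: real
  assume \<eta>: "0 < \<eta>" "\<eta> < 1"
    and half: "\<And>x h s m A. 0 < h \<Longrightarrow> A \<subseteq> {s..<s + m} \<Longrightarrow> real (card A) \<le> \<eta> * real m \<Longrightarrow>
      (\<Sum>j\<in>A. um u (cell x h j)) \<le> (\<Sum>j\<in>{s..<s + m}. um u (cell x h j)) / 2"
  define \<delta> where "\<delta> = ln 2 / ln (2 / \<eta>)"
  have "ln 2 < ln (2 / \<eta>)" using \<eta> by (subst ln_less_cancel_iff) (auto simp: field_simps)
  moreover from this have "0 < ln (2 / \<eta>)" using ln_gt_zero[of "2 :: real"] by linarith
  ultimately have \<delta>: "0 < \<delta>" "\<delta> < 1" by (auto simp: \<delta>_def)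
  have main: "um u E \<le> 2 * 2 powr \<delta> * (measure lebesgue E / (b - a)) powr \<delta> * um u {a..b}"
    if ab: "a < b" and E: "E \<in> sets lebesgue" "E \<subseteq> {a..b}" for a b E
  proof -
    have Elm: "E \<in> lmeasurable"
      using E by (metis bounded_closed_interval bounded_set_imp_lmeasurable bounded_subset)
    show ?thesis
    proof (cases "measure lebesgue E = 0")
      \<comment> \<open>The outer approximation needs a positive excess, here the measure of
        \<open>E\<close> itself; null sets are settled by absolute continuity.\<close>
      case True
      then have "E \<in> null_sets lebesgue"
        using emeasure_eq_measure2[OF Elm] E(1) by (intro null_setsI) auto
      then have "umeas u E \<le> umeas u {}"
        by (intro umeas_mono_AE) (auto dest: AE_not_in)
      then show ?thesis by simp
    next
      case False
      then have E0: "0 < measure lebesgue E" by (simp add: zero_less_measure_iff)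
      obtain T where T: "open T" "E \<subseteq> T" "T - E \<in> lmeasurable"
        "emeasure lebesgue (T - E) < ennreal (measure lebesgue E)"
        using sets_lebesgue_outer_open[OF E(1) E0] by blast
      have TE: "T = E \<union> (T - E)" using T by auto
      have Tlm: "T \<in> lmeasurable" using fmeasurable.Un[OF Elm T(3)] TE by simp
      have "measure lebesgue (T - E) \<le> measure lebesgue E"
        using T(4) by (intro enn2real_leI[of _ "emeasure lebesgue (T - E)", folded measure_def]) auto
      moreover have "measure lebesgue T \<le> measure lebesgue E + measure lebesgue (T - E)"
        using measure_Un_le[of E lebesgue "T - E"] E T(3) TE by (metis fmeasurableD)
      ultimately have mT: "measure lebesgue T \<le> 2 * measure lebesgue E" by simp
      define B where "B = 2 * 2 powr \<delta> * (measure lebesgue E / (b - a)) powr \<delta> * um u {a..b}"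
      have "um u (T \<inter> {a..b}) \<le> B"
      proof (rule um_le_of_dyadic_bound[OF u ab T(1)])
        show "0 \<le> B" by (simp add: B_def)
        fix N :: nat and A :: "nat set"
        define h where "h = (b - a) / 2 ^ N"
        assume A: "A \<subseteq> {..<2 ^ N}" and sub: "(\<Union>j\<in>A. cell a ((b - a) / 2 ^ N) j) \<subseteq> T"
        have h: "0 < h" "2 ^ N * h = b - a" using ab by (auto simp: h_def)
        have finA: "finite A" using finite_subset[OF A] by simp
        have "real (card A) * h = measure lebesgue (\<Union>j\<in>A. cell a h j)"
          using measure_Union_cells[of h A a] h finA by simp
        also have "\<dots> \<le> measure lebesgue T"
          using sub finA Tlm unfolding h_def[symmetric]
          by (intro measure_mono_fmeasurable sets.finite_UN) auto
        also note mT
        finally have "real (card A) * h / (b - a) \<le> 2 * measure lebesgue E / (b - a)"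
          using ab by (intro divide_right_mono) auto
        moreover have "real (card A) * h / (b - a) = card A / 2 ^ N"
          using ab by (simp add: h_def)
        ultimately have ratio: "card A / 2 ^ N \<le> 2 * (measure lebesgue E / (b - a))" by simp
        have "um u (\<Union>j\<in>A. cell a h j) = (\<Sum>j\<in>A. um u (cell a h j))"
          using um_Union_cells[OF u, of h A a] h finA by simp
        also have "\<dots> \<le> 2 * (card A / 2 ^ N) powr \<delta> * (\<Sum>j<2 ^ N. um u (cell a h j))"
          unfolding \<delta>_def
          by (rule dyadic_power_decay[OF \<eta> _ half A]) (use h in auto)
        also have "(\<Sum>j<2 ^ N. um u (cell a h j)) = um u {a..b}"
          using um_block[OF u, of h a 0 "2 ^ N"] h by (simp add: atLeast0LessThan)
        also have "2 * (card A / 2 ^ N) powr \<delta> * um u {a..b}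
            \<le> 2 * (2 * (measure lebesgue E / (b - a))) powr \<delta> * um u {a..b}"
          using ratio \<delta> by (intro mult_right_mono mult_left_mono powr_mono2) auto
        also have "\<dots> = B"
          unfolding B_def using ab by (subst powr_mult) (auto simp: mult.assoc)
        finally show "um u (\<Union>j\<in>A. cell a ((b - a) / 2 ^ N) j) \<le> B" by (simp add: h_def)
      qed
      moreover have "um u E \<le> um u (T \<inter> {a..b})"
        using T(2) E(2) by (intro um_mono[OF u, of _ _ a b]) auto
      ultimately show ?thesis by (simp add: B_def)
    qed
  qed
  show "A_infty u"
    unfolding A_infty_def
  proof (intro exI conjI allI impI)
    show "0 < 2 * 2 powr \<delta>" "0 < \<delta>" "\<delta> < 1" using \<delta> by auto
    fix a b :: real and E assume ab: "a < b" "E \<in> sets lebesgue" "E \<subseteq> {a..b}"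
    show "um u E / um u {a..b} \<le> 2 * 2 powr \<delta> * (measure lebesgue E / (b - a)) powr \<delta>"
      \<comment> \<open>If the denominator is 0, the quotient is 0 by convention.\<close>
      using main[OF ab] by (cases "um u {a..b} = 0") (auto simp: divide_le_eq less_le)
  qed
qed

end

theorem theorem3p5:
  fixes u w :: "real \<Rightarrow> real" and p :: real
  assumes "weight_R u" and "weight_pos w" and "0 < p" and "hilbert_bounded u w p"
  shows "A_infty u"
proof (rule restricted_weak_type[OF assms])
  fix C :: real
  assume C: "0 < C"
    and restricted: "\<And>f S l a b a' b'. f \<in> borel_measurable lebesgue \<Longrightarrow> (\<forall>x. \<bar>f x\<bar> \<le> 1) \<Longrightarrow>
      (\<forall>x. x \<notin> {a..b} \<longrightarrow> f x = 0) \<Longrightarrow> S \<subseteq> {a'..b'} \<Longrightarrow>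
      (AE x in lebesgue. x \<in> S \<longrightarrow> l \<le> \<bar>hilbert f x\<bar>) \<Longrightarrow> 0 < l \<Longrightarrow>
      l powr p * W w (um u S) \<le> C * W w (um u {a..b})"
  interpret hilbert_restricted u w p C
    by (intro hilbert_restricted.intro assms C W_um_interval_pos[OF assms]) (assumption, rule restricted)
  show ?thesis by (rule A_infty_u)
qed

end
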